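(* Let $R$ be a commutative unital ring, $N\geq 2$ a (finite) natural number and $r,s\geq 0$. The identity adjunction with left adjoint $\mathrm{id}\colon (N\text{-}\mathrm{mC}_R)_{r,s}\to (N\text{-}\mathrm{mC}_R)_{r,s}^{\flat}$ replaced as follows: the two model structures $(N\text{-}\mathrm{mC}_R)_r$ and $(N\text{-}\mathrm{mC}_R)_{r,s}$ on the category $N\text{-}\mathrm{mC}_R$ are related by the adjunction whose left adjoint is the identity functor in one direction and whose right adjoint is the identity functor $(N\text{-}\mathrm{mC}_R)_{r,s}\to (N\text{-}\mathrm{mC}_R)_{r}$, the left adjoint being the identity functor $(N\text{-}\mathrm{mC}_R)_{r}\to (N\text{-}\mathrm{mC}_R)_{r,s}$. This adjunction is a Quillen adjunction but not a Quillen equivalence.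
   Context: Multicomplexes. A bigraded $R$-module is a collection $A=\{A^{p,q}\}_{(p,q)\in\mathbb{Z}^2}$ of $R$-modules. An $N$-multicomplex is a bigraded $R$-module $A$ with maps $d_i\colon A\to A$, $i\geq 0$, of bidegree $(-i,1-i)$, such that $\sum_{i+j=l}(-1)^i d_id_j=0$ for all $l\geq 0$ and $d_i=0$ for all $i\geq N$. A (strict) morphism $f\colon A\to B$ is a bidegree $(0,0)$ map of bigraded $R$-modules with $d_if=fd_i$ for all $i$. The resulting category is $N\text{-}\mathrm{mC}_R$. Involution. Let $\mathfrak{o}(p,q)=((N-2)p-(N-1)q,\,(N-3)p-(N-2)q)$ on $\mathbb{Z}^2$. For an $N$-multicomplex $A$, $A^{\mathfrak{o}}$ is the $N$-multicomplex with $(A^{\mathfrak{o}})^{p,q}=A^{\mathfrak{o}(p,q)}$, $(d^{\mathfrak{o}})_i=d_{N-1-i}$ for $0\le i\le N-1$ (and $0$ for $i\geq N$); on morphisms $(f^{\mathfrak{o}})^{p,q}=f^{\mathfrak{o}(p,q)}$. Spectral sequences. For an $N$-multicomplex $A$: $ZW_0^{p,q}(A)=A^{p,q}$ and, for $r\geq 1$, $ZW_r^{p,q}(A)$ is the $R$-module of tuples $(a_0,\dots,a_{r-1})$ with $a_i\in A^{p-i,q-i}$ and $\sum_{i+j=l}(-1)^id_ia_j=0$ for $0\leq l\leq r-1$. Also $BW_0^{p,q}(A)=0$, $BW_1^{p,q}(A)=A^{p,q}$ and, for $r\geq 2$, $BW_r^{p,q-1}(A)=ZW_{r-1}^{p+r-1,q+r-2}(A)\oplus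 A^{p,q-1}\oplus ZW_{r-1}^{p-1,q-1}(A)$. The map $w_r\colon BW_r^{p,q-1}(A)\to ZW_r^{p,q}(A)$ is $w_0=0$, $w_1=d_0$, and for $r\geq 2$ it sends $(b_0,\dots,b_{r-2};a;c_0,\dots,c_{r-2})$ to the tuple whose $j$-th entry ($0\leq j\leq r-1$) is $d_ja+(-1)^j\sum_{i=j+1}^{r-1+j}(-1)^id_ib_{r-1+j-i}+c_{j-1}$, with $c_{-1}:=0$. The $r$-page of the (first) spectral sequence of $A$ (that of the total complex filtered by columns) is $E_r^{p,q}(A)\cong ZW_r^{p,q}(A)/w_r(BW_r^{p,q-1}(A))$, a morphism $f$ acting entrywise; the homology of $E_r(A)$ is $E_{r+1}(A)$, so $E_r(f)$ is a quasi-isomorphism iff $E_{r+1}(f)$ is an isomorphism. Put ${}'E(A)=E(A)$ and ${}''E(A)=E(A^{\mathfrak{o}})$. Model structures. $(N\text{-}\mathrm{mC}_R)_r$ denotes the (known) model structure on $N\text{-}\mathrm{mC}_R$ whose weak equivalences are the morphisms $f$ such that ${}'E_r(f)$ is a quasi-isomorphism and whose fibrations are the morphisms $f$ such that ${}'E_i(f)$ is bidegreewise surjective for every $0\leq i\leq r$. $(N\text{-}\mathrm{mC}_R)_{r,s}$ denotes the model structure on $N\text{-}\mathrm{mC}_R$ whose weak equivalences are the morphisms $f$ such that ${}'E_r(f)$ and ${}''E_s(f)$ are quasi-isomorphisms and whose fibrations are the morphisms $f$ such that ${}'E_i(f)$ and ${}''E_j(f)$ are bidegreewise surjective for every $0\leq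 i\leq r$ and $0\leq j\leq s$.
   Formalization: The ring R is assumed nonzero (over the zero ring every multicomplex is zero and the identity adjunction is a Quillen equivalence); R-modules are taken with carriers in an arbitrary fixed type into which R embeds. *)

theory Defs
  imports "HOL-Algebra.Module" "HOL-Algebra.AbelCoset" "HOL-Library.FuncSet" "HOL-Library.Product_Plus"
begin

section \<open>Categories, functors, adjunctions\<close>

record ('o, 'a) cat =
  Ob :: "'o set"
  Ar :: "'a set"
  Dom :: "'a \<Rightarrow> 'o"
  Cod :: "'a \<Rightarrow> 'o"
  Idt :: "'o \<Rightarrow> 'a"
  Cmp :: "'a \<Rightarrow> 'a \<Rightarrow> 'a"  \<comment> \<open>\<open>Cmp C g f\<close> is \<open>g\<close> after \<open>f\<close>\<close>

definition Hom :: "('o, 'a) cat \<Rightarrow> 'o \<Rightarrow> 'o \<Rightarrow> 'a set" where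
  "Hom C X Y = {f \<in> Ar C. Dom C f = X \<and> Cod C f = Y}"

locale category =
  fixes C :: "('o, 'a) cat"
  assumes dom_ob: "f \<in> Ar C \<Longrightarrow> Dom C f \<in> Ob C"
    and cod_ob: "f \<in> Ar C \<Longrightarrow> Cod C f \<in> Ob C"
    and id_hom: "X \<in> Ob C \<Longrightarrow> Idt C X \<in> Hom C X X"
    and comp_hom: "f \<in> Hom C X Y \<Longrightarrow> g \<in> Hom C Y Z \<Longrightarrow> Cmp C g f \<in> Hom C X Z"
    and id_right: "f \<in> Hom C X Y \<Longrightarrow> Cmp C f (Idt C X) = f"
    and id_left: "f \<in> Hom C X Y \<Longrightarrow> Cmp C (Idt C Y) f = f"
    and assoc: "f \<in> Hom C X Y \<Longrightarrow> g \<in> Hom C Y Z \<Longrightarrow> h \<in> Hom C Z W \<Longrightarrow>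
                  Cmp C h (Cmp C g f) = Cmp C (Cmp C h g) f"

definition initial_ob :: "('o, 'a) cat \<Rightarrow> 'o \<Rightarrow> bool" where
  "initial_ob C I \<longleftrightarrow> I \<in> Ob C \<and> (\<forall>X \<in> Ob C. \<exists>!f. f \<in> Hom C I X)"

definition terminal_ob :: "('o, 'a) cat \<Rightarrow> 'o \<Rightarrow> bool" where
  "terminal_ob C T \<longleftrightarrow> T \<in> Ob C \<and> (\<forall>X \<in> Ob C. \<exists>!f. f \<in> Hom C X T)"

record ('o, 'a, 'p, 'b) functr =
  fun_ob :: "'o \<Rightarrow> 'p"
  fun_ar :: "'a \<Rightarrow> 'b"

locale is_functor = C: category C + D: category D
  for C :: "('o, 'a) cat" and D :: "('p, 'b) cat" +
  fixes F :: "('o, 'a, 'p, 'b) functr"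
  assumes map_ob: "X \<in> Ob C \<Longrightarrow> fun_ob F X \<in> Ob D"
    and map_ar: "f \<in> Hom C X Y \<Longrightarrow> fun_ar F f \<in> Hom D (fun_ob F X) (fun_ob F Y)"
    and map_id: "X \<in> Ob C \<Longrightarrow> fun_ar F (Idt C X) = Idt D (fun_ob F X)"
    and map_comp: "f \<in> Hom C X Y \<Longrightarrow> g \<in> Hom C Y Z \<Longrightarrow>
                     fun_ar F (Cmp C g f) = Cmp D (fun_ar F g) (fun_ar F f)"

definition id_functor :: "('o, 'a, 'o, 'a) functr" where
  "id_functor = \<lparr>fun_ob = \<lambda>X. X, fun_ar = \<lambda>f. f\<rparr>"

locale adjunction = F: is_functor C D F + G: is_functor D C G
  for C :: "('o, 'a) cat" and D :: "('p, 'b) cat"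
    and F :: "('o, 'a, 'p, 'b) functr" and G :: "('p, 'b, 'o, 'a) functr" +
  fixes \<phi> :: "'o \<Rightarrow> 'p \<Rightarrow> 'b \<Rightarrow> 'a"
  assumes hom_bij: "X \<in> Ob C \<Longrightarrow> Y \<in> Ob D \<Longrightarrow>
            bij_betw (\<phi> X Y) (Hom D (fun_ob F X) Y) (Hom C X (fun_ob G Y))"
    and hom_natural: "u \<in> Hom C X' X \<Longrightarrow> f \<in> Hom D (fun_ob F X) Y \<Longrightarrow> v \<in> Hom D Y Y' \<Longrightarrow>
            \<phi> X' Y' (Cmp D v (Cmp D f (fun_ar F u)))
              = Cmp C (fun_ar G v) (Cmp C (\<phi> X Y f) u)"

section \<open>Model structures\<close>

text \<open>Existence of limits and colimits is a property of the underlying category and is not part of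
  a model structure on it; factorizations are not required to be functorial.\<close>

record 'a model_classes =
  Weq :: "'a set"
  Cof :: "'a set"
  Fib :: "'a set"

definition retract_of :: "('o, 'a) cat \<Rightarrow> 'a \<Rightarrow> 'a \<Rightarrow> bool" where
  "retract_of C f g \<longleftrightarrow> f \<in> Ar C \<and> g \<in> Ar C \<and>
     (\<exists>i \<in> Hom C (Dom C f) (Dom C g). \<exists>p \<in> Hom C (Dom C g) (Dom C f).
      \<exists>j \<in> Hom C (Cod C f) (Cod C g). \<exists>q \<in> Hom C (Cod C g) (Cod C f).
        Cmp C p i = Idt C (Dom C f) \<and> Cmp C q j = Idt C (Cod C f) \<and>
        Cmp C g i = Cmp C j f \<and> Cmp C f p = Cmp C q g)"

definition lifts :: "('o, 'a) cat \<Rightarrow> 'a \<Rightarrow> 'a \<Rightarrow> bool" where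
  "lifts C i p \<longleftrightarrow>
     (\<forall>u \<in> Hom C (Dom C i) (Dom C p). \<forall>v \<in> Hom C (Cod C i) (Cod C p).
        Cmp C p u = Cmp C v i \<longrightarrow>
        (\<exists>h \<in> Hom C (Cod C i) (Dom C p). Cmp C h i = u \<and> Cmp C p h = v))"

locale model_structure = category C for C :: "('o, 'a) cat" +
  fixes M :: "'a model_classes"
  assumes classes: "Weq M \<subseteq> Ar C" "Cof M \<subseteq> Ar C" "Fib M \<subseteq> Ar C"
    and two_of_three:
      "f \<in> Hom C X Y \<Longrightarrow> g \<in> Hom C Y Z \<Longrightarrow> f \<in> Weq M \<Longrightarrow> g \<in> Weq M \<Longrightarrow> Cmp C g f \<in> Weq M"
      "f \<in> Hom C X Y \<Longrightarrow> g \<in> Hom C Y Z \<Longrightarrow> f \<in> Weq M \<Longrightarrow> Cmp C g f \<in> Weq M \<Longrightarrow> g \<in> Weq M"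
      "f \<in> Hom C X Y \<Longrightarrow> g \<in> Hom C Y Z \<Longrightarrow> g \<in> Weq M \<Longrightarrow> Cmp C g f \<in> Weq M \<Longrightarrow> f \<in> Weq M"
    and retracts:
      "retract_of C f g \<Longrightarrow> g \<in> Weq M \<Longrightarrow> f \<in> Weq M"
      "retract_of C f g \<Longrightarrow> g \<in> Cof M \<Longrightarrow> f \<in> Cof M"
      "retract_of C f g \<Longrightarrow> g \<in> Fib M \<Longrightarrow> f \<in> Fib M"
    and lifting:
      "i \<in> Cof M \<inter> Weq M \<Longrightarrow> p \<in> Fib M \<Longrightarrow> lifts C i p"
      "i \<in> Cof M \<Longrightarrow> p \<in> Fib M \<inter> Weq M \<Longrightarrow> lifts C i p"
    and factorization:
      "f \<in> Hom C X Y \<Longrightarrow> \<exists>Z. \<exists>i \<in> Hom C X Z. \<exists>p \<in> Hom C Z Y.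
          i \<in> Cof M \<inter> Weq M \<and> p \<in> Fib M \<and> Cmp C p i = f"
      "f \<in> Hom C X Y \<Longrightarrow> \<exists>Z. \<exists>i \<in> Hom C X Z. \<exists>p \<in> Hom C Z Y.
          i \<in> Cof M \<and> p \<in> Fib M \<inter> Weq M \<and> Cmp C p i = f"

definition cofibrant :: "('o, 'a) cat \<Rightarrow> 'a model_classes \<Rightarrow> 'o \<Rightarrow> bool" where
  "cofibrant C M X \<longleftrightarrow> X \<in> Ob C \<and> (\<exists>I. initial_ob C I \<and> (\<exists>f \<in> Hom C I X. f \<in> Cof M))"

definition fibrant :: "('o, 'a) cat \<Rightarrow> 'a model_classes \<Rightarrow> 'o \<Rightarrow> bool" where
  "fibrant C M X \<longleftrightarrow> X \<in> Ob C \<and> (\<exists>T. terminal_ob C T \<and> (\<exists>f \<in> Hom C X T. f \<in> Fib M))"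

locale quillen_adjunction =
  adjunction C D F G \<phi> + MC: model_structure C M + MD: model_structure D P
  for C :: "('o, 'a) cat" and M :: "'a model_classes"
    and D :: "('p, 'b) cat" and P :: "'b model_classes"
    and F :: "('o, 'a, 'p, 'b) functr" and G :: "('p, 'b, 'o, 'a) functr"
    and \<phi> :: "'o \<Rightarrow> 'p \<Rightarrow> 'b \<Rightarrow> 'a" +
  assumes pres_cof: "f \<in> Cof M \<Longrightarrow> fun_ar F f \<in> Cof P"
    and pres_triv_cof: "f \<in> Cof M \<inter> Weq M \<Longrightarrow> fun_ar F f \<in> Cof P \<inter> Weq P"

locale quillen_equivalence = quillen_adjunction C M D P F G \<phi>
  for C :: "('o, 'a) cat" and M :: "'a model_classes"
    and D :: "('p, 'b) cat" and P :: "'b model_classes"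
    and F :: "('o, 'a, 'p, 'b) functr" and G :: "('p, 'b, 'o, 'a) functr"
    and \<phi> :: "'o \<Rightarrow> 'p \<Rightarrow> 'b \<Rightarrow> 'a" +
  assumes weq_adjunct: "cofibrant C M X \<Longrightarrow> fibrant D P Y \<Longrightarrow> f \<in> Hom D (fun_ob F X) Y \<Longrightarrow>
            f \<in> Weq P \<longleftrightarrow> \<phi> X Y f \<in> Weq M"

section \<open>Linear maps and quotient modules\<close>

definition mod_hom :: "'r ring \<Rightarrow> ('r, 'u) module \<Rightarrow> ('r, 'v) module \<Rightarrow> ('u \<Rightarrow> 'v) set" where
  "mod_hom R A B = {f \<in> carrier A \<rightarrow> carrier B.
     (\<forall>x \<in> carrier A. \<forall>y \<in> carrier A. f (x \<oplus>\<^bsub>A\<^esub> y) = f x \<oplus>\<^bsub>B\<^esub> f y) \<and>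
     (\<forall>c \<in> carrier R. \<forall>x \<in> carrier A. f (c \<odot>\<^bsub>A\<^esub> x) = c \<odot>\<^bsub>B\<^esub> f x)}"

definition mod_iso :: "'r ring \<Rightarrow> ('r, 'u) module \<Rightarrow> ('r, 'v) module \<Rightarrow> ('u \<Rightarrow> 'v) set" where
  "mod_iso R A B = {f \<in> mod_hom R A B. bij_betw f (carrier A) (carrier B)}"

text \<open>The library's module records extend ring records; the fields \<open>mult\<close> and \<open>one\<close> play no role
  in a module and are filled arbitrarily.\<close>

definition quot_module :: "('r, 'u) module \<Rightarrow> 'u set \<Rightarrow> ('r, 'u set) module" where
  "quot_module A S = \<lparr>carrier = a_rcosets\<^bsub>A\<^esub> S, mult = (\<lambda>X Y. S), one = S,
     zero = S, add = set_add A, smult = (\<lambda>c X. \<Union>x \<in> X. S +>\<^bsub>A\<^esub> (c \<odot>\<^bsub>A\<^esub> x))\<rparr>"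

section \<open>Multicomplexes\<close>

type_synonym bideg = "int \<times> int"

record ('r, 'u) mcomplex =
  cmpt :: "bideg \<Rightarrow> ('r, 'u) module"
  diff :: "nat \<Rightarrow> bideg \<Rightarrow> 'u \<Rightarrow> 'u"
    \<comment> \<open>\<open>diff A i pq\<close> is \<open>d\<^sub>i\<close> on the component of bidegree \<open>pq\<close>\<close>

definition alt :: "('r, 'u) module \<Rightarrow> nat \<Rightarrow> 'u \<Rightarrow> 'u" where
  "alt A i x = (if even i then x else \<ominus>\<^bsub>A\<^esub> x)"  \<comment> \<open>\<open>(-1)\<^sup>i x\<close>\<close>

definition dbideg :: "nat \<Rightarrow> bideg" where
  "dbideg i = (- int i, 1 - int i)"

definition multicomplex :: "'r ring \<Rightarrow> nat \<Rightarrow> ('r, 'u) mcomplex \<Rightarrow> bool" where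
  "multicomplex R N A \<longleftrightarrow>
     (\<forall>pq. module R (cmpt A pq)) \<and>
     (\<forall>i pq. diff A i pq \<in> mod_hom R (cmpt A pq) (cmpt A (pq + dbideg i))) \<and>
     (\<forall>l pq. \<forall>x \<in> carrier (cmpt A pq). let B = cmpt A (pq + (- int l, 2 - int l)) in
        (\<Oplus>\<^bsub>B\<^esub>i \<in> {..l}. alt B i (diff A i (pq + dbideg (l - i)) (diff A (l - i) pq x))) = \<zero>\<^bsub>B\<^esub>) \<and>
     (\<forall>i \<ge> N. \<forall>pq. \<forall>x \<in> carrier (cmpt A pq). diff A i pq x = \<zero>\<^bsub>cmpt A (pq + dbideg i)\<^esub>)"

text \<open>An arrow is a triple of source, target and underlying family of maps.  The maps are
  extensional, so that equality of arrows is equality of maps on the carriers.\<close>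

type_synonym ('r, 'u) mc_arrow =
  "('r, 'u) mcomplex \<times> ('r, 'u) mcomplex \<times> (bideg \<Rightarrow> 'u \<Rightarrow> 'u)"

definition mc_hom :: "'r ring \<Rightarrow> ('r, 'u) mcomplex \<Rightarrow> ('r, 'u) mcomplex \<Rightarrow> (bideg \<Rightarrow> 'u \<Rightarrow> 'u) set" where
  "mc_hom R A B = {f.
     (\<forall>pq. f pq \<in> mod_hom R (cmpt A pq) (cmpt B pq) \<inter> extensional (carrier (cmpt A pq))) \<and>
     (\<forall>i pq. \<forall>x \<in> carrier (cmpt A pq).
        diff B i pq (f pq x) = f (pq + dbideg i) (diff A i pq x))}"

text \<open>The category of \<open>N\<close>-multicomplexes over \<open>R\<close> whose components have carriers inside the type
  \<open>'u\<close>, which plays the role of the universe of small sets.  For this to be a meaningful category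
  \<open>'u\<close> has to be large enough; in particular the carrier of \<open>R\<close> should embed into it.\<close>

definition mC :: "'r ring \<Rightarrow> nat \<Rightarrow> (('r, 'u) mcomplex, ('r, 'u) mc_arrow) cat" where
  "mC R N = \<lparr>
     Ob = {A. multicomplex R N A},
     Ar = {(A, B, f). multicomplex R N A \<and> multicomplex R N B \<and> f \<in> mc_hom R A B},
     Dom = (\<lambda>(A, B, f). A),
     Cod = (\<lambda>(A, B, f). B),
     Idt = (\<lambda>A. (A, A, \<lambda>pq. \<lambda>x \<in> carrier (cmpt A pq). x)),
     Cmp = (\<lambda>(B', C, g) (A, B, f). (A, C, \<lambda>pq. compose (carrier (cmpt A pq)) (g pq) (f pq)))\<rparr>"

subsection \<open>The involution\<close>

definition inv_bideg :: "nat \<Rightarrow> bideg \<Rightarrow> bideg" where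
  "inv_bideg N = (\<lambda>(p, q). ((int N - 2) * p - (int N - 1) * q, (int N - 3) * p - (int N - 2) * q))"

definition inv_mc :: "nat \<Rightarrow> ('r, 'u) mcomplex \<Rightarrow> ('r, 'u) mcomplex" where
  "inv_mc N A = \<lparr>cmpt = (\<lambda>pq. cmpt A (inv_bideg N pq)),
     diff = (\<lambda>i pq. if i < N then diff A (N - 1 - i) (inv_bideg N pq)
                    else (\<lambda>x. \<zero>\<^bsub>cmpt A (inv_bideg N (pq + dbideg i))\<^esub>))\<rparr>"

definition inv_ar :: "nat \<Rightarrow> ('r, 'u) mc_arrow \<Rightarrow> ('r, 'u) mc_arrow" where
  "inv_ar N = (\<lambda>(A, B, f). (inv_mc N A, inv_mc N B, \<lambda>pq. f (inv_bideg N pq)))"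

subsection \<open>The pages of the spectral sequence\<close>

text \<open>Tuples are lists; an element of \<open>ZW\<^sub>0\<close> is a list of length one.\<close>

definition ZW :: "('r, 'u) mcomplex \<Rightarrow> nat \<Rightarrow> bideg \<Rightarrow> 'u list set" where
  "ZW A r = (\<lambda>(p, q).
     {a. length a = max 1 r \<and>
         (\<forall>i < length a. a ! i \<in> carrier (cmpt A (p - int i, q - int i))) \<and>
         (\<forall>l < r. let B = cmpt A (p - int l, q + 1 - int l) in
            (\<Oplus>\<^bsub>B\<^esub>i \<in> {..l}. alt B i (diff A i (p - int (l - i), q - int (l - i)) (a ! (l - i))))
              = \<zero>\<^bsub>B\<^esub>)})"

definition ZW_module :: "('r, 'u) mcomplex \<Rightarrow> nat \<Rightarrow> bideg \<Rightarrow> ('r, 'u list) module" where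
  "ZW_module A r = (\<lambda>(p, q). let n = max 1 r; B = (\<lambda>i. cmpt A (p - int i, q - int i)) in
     \<lparr>carrier = ZW A r (p, q), mult = (\<lambda>a b. []), one = [],
      zero = map (\<lambda>i. \<zero>\<^bsub>B i\<^esub>) [0..<n],
      add = (\<lambda>a b. map (\<lambda>i. a ! i \<oplus>\<^bsub>B i\<^esub> b ! i) [0..<n]),
      smult = (\<lambda>c a. map (\<lambda>i. c \<odot>\<^bsub>B i\<^esub> a ! i) [0..<n])\<rparr>)"

text \<open>An element of \<open>BW\<^sub>r\<close> is always a triple \<open>(b, a, c)\<close>; for \<open>r = 1\<close> only \<open>a\<close> carries information.
  The source of \<open>w\<^sub>r\<close> is \<open>BW\<^sub>r\<close> in bidegree \<open>(p, q - 1)\<close>, whereas \<open>BW A r\<close> is stated in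
  bidegree \<open>(p, q)\<close>, which shifts the second degrees below by one.\<close>

definition BW :: "('r, 'u) mcomplex \<Rightarrow> nat \<Rightarrow> bideg \<Rightarrow> ('u list \<times> 'u \<times> 'u list) set" where
  "BW A r = (\<lambda>(p, q).
     if r = 0 then {([], \<zero>\<^bsub>cmpt A (p, q)\<^esub>, [])}
     else if r = 1 then {[]} \<times> carrier (cmpt A (p, q)) \<times> {[]}
     else ZW A (r - 1) (p + int r - 1, q + int r - 1) \<times> carrier (cmpt A (p, q))
            \<times> ZW A (r - 1) (p - 1, q))"

definition w_map :: "('r, 'u) mcomplex \<Rightarrow> nat \<Rightarrow> bideg \<Rightarrow> 'u list \<times> 'u \<times> 'u list \<Rightarrow> 'u list" where
  "w_map A r = (\<lambda>(p, q) (b, a, c).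
     if r = 0 then [\<zero>\<^bsub>cmpt A (p, q)\<^esub>]
     else if r = 1 then [diff A 0 (p, q - 1) a]
     else map (\<lambda>j. let B = cmpt A (p - int j, q - int j) in
         diff A j (p, q - 1) a
         \<oplus>\<^bsub>B\<^esub> alt B j (\<Oplus>\<^bsub>B\<^esub>i \<in> {j + 1..r - 1 + j}. let k = r - 1 + j - i in
              alt B i (diff A i (p + int r - 1 - int k, q + int r - 2 - int k) (b ! k)))
         \<oplus>\<^bsub>B\<^esub> (if j = 0 then \<zero>\<^bsub>B\<^esub> else c ! (j - 1))) [0..<r])"

definition w_image :: "('r, 'u) mcomplex \<Rightarrow> nat \<Rightarrow> bideg \<Rightarrow> 'u list set" where
  "w_image A r = (\<lambda>(p, q). w_map A r (p, q) ` BW A r (p, q - 1))"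

definition page :: "('r, 'u) mcomplex \<Rightarrow> nat \<Rightarrow> bideg \<Rightarrow> ('r, 'u list set) module" where
  "page A r pq = quot_module (ZW_module A r pq) (w_image A r pq)"

definition tuple_map :: "(bideg \<Rightarrow> 'u \<Rightarrow> 'u) \<Rightarrow> bideg \<Rightarrow> 'u list \<Rightarrow> 'u list" where
  "tuple_map f = (\<lambda>(p, q) a. map (\<lambda>i. f (p - int i, q - int i) (a ! i)) [0..<length a])"

text \<open>The induced map sends the coset of \<open>a\<close> to the coset of its image; the union below is over
  all representatives of the coset, which all contribute the same coset.\<close>

definition page_map :: "('r, 'u) mc_arrow \<Rightarrow> nat \<Rightarrow> bideg \<Rightarrow> 'u list set \<Rightarrow> 'u list set" where
  "page_map = (\<lambda>(A, B, f) r pq X.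
     \<Union>a \<in> X. w_image B r pq +>\<^bsub>ZW_module B r pq\<^esub> tuple_map f pq a)"

definition page_surj :: "nat \<Rightarrow> ('r, 'u) mc_arrow \<Rightarrow> bool" where
  "page_surj r = (\<lambda>(A, B, f).
     \<forall>pq. page_map (A, B, f) r pq ` carrier (page A r pq) = carrier (page B r pq))"

text \<open>The homology of the \<open>r\<close>-page is the \<open>(r + 1)\<close>-page, hence the shift of the index.\<close>

definition page_quasi_iso :: "'r ring \<Rightarrow> nat \<Rightarrow> ('r, 'u) mc_arrow \<Rightarrow> bool" where
  "page_quasi_iso R r = (\<lambda>(A, B, f).
     \<forall>pq. page_map (A, B, f) (r + 1) pq \<in> mod_iso R (page A (r + 1) pq) (page B (r + 1) pq))"

subsection \<open>The two model structures\<close>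

definition is_model_r ::
    "'r ring \<Rightarrow> nat \<Rightarrow> nat \<Rightarrow> ('r, 'u) mc_arrow model_classes \<Rightarrow> bool" where
  "is_model_r R N r M \<longleftrightarrow> model_structure (mC R N) M \<and>
     Weq M = {f \<in> Ar (mC R N). page_quasi_iso R r f} \<and>
     Fib M = {f \<in> Ar (mC R N). \<forall>i \<le> r. page_surj i f}"

definition is_model_rs ::
    "'r ring \<Rightarrow> nat \<Rightarrow> nat \<Rightarrow> nat \<Rightarrow> ('r, 'u) mc_arrow model_classes \<Rightarrow> bool" where
  "is_model_rs R N r s M \<longleftrightarrow> model_structure (mC R N) M \<and>
     Weq M = {f \<in> Ar (mC R N). page_quasi_iso R r f \<and> page_quasi_iso R s (inv_ar N f)} \<and>
     Fib M = {f \<in> Ar (mC R N). (\<forall>i \<le> r. page_surj i f) \<and> (\<forall>j \<le> s. page_surj j (inv_ar N f))}"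

end

theory Submission
  imports Defs "HOL-Algebra.Ideal"
begin

text \<open>
  The fibrations and weak equivalences of the structure \<open>M\<^sub>r\<^sub>s\<close> are fibrations and weak equivalences
  of \<open>M\<^sub>r\<close>, since they satisfy the same conditions on the first spectral sequence and further ones on
  the second.  Cofibrations and trivial cofibrations are determined by left lifting properties, which
  only become weaker when there are fewer maps to lift against.  So the identity functor from
  \<open>M\<^sub>r\<close> to \<open>M\<^sub>r\<^sub>s\<close> preserves both: this is \<open>id_quillen_adjunction\<close>.

  If the adjunction were a Quillen equivalence, every map from the zero object that is a weak
  equivalence in \<open>M\<^sub>r\<close> would be one in \<open>M\<^sub>r\<^sub>s\<close> (\<open>quillen_equivalence_weq_from_initial\<close>): the
  zero object is cofibrant, and the target may be replaced by a fibrant one.  Therefore it is enough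
  to find a multicomplex \<open>A\<close> whose first spectral sequence vanishes from page 1 on, but whose second one
  does not vanish on any page.  Such an \<open>A\<close> is the sum of \<open>N - 1\<close> infinite staircases, with generators
  \<open>a\<^sub>i\<close> in bidegree \<open>(-i, -i - 1)\<close> and \<open>b\<^sub>i\<close> in bidegree \<open>(-i, -i)\<close> for \<open>i \<ge> 0\<close>, and

    \<open>d\<^sub>0 a\<^sub>i = b\<^sub>i\<close>  and  \<open>d\<^bsub>N-1\<^esub> a\<^sub>i = b\<^bsub>i+N-1\<^esub>\<close>.

  Here \<open>d\<^sub>0\<close> maps the span of the \<open>a\<^sub>i\<close> isomorphically onto the span of the \<open>b\<^sub>i\<close>, so that the first
  spectral sequence vanishes (\<open>staircase_page_zero\<close>).  The involution exchanges \<open>d\<^sub>0\<close> and \<open>d\<^bsub>N-1\<^esub>\<close>.  The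
  map \<open>d\<^bsub>N-1\<^esub>\<close> is injective on the span of the \<open>a\<^sub>i\<close> but misses \<open>b\<^sub>0\<close>, and \<open>b\<^sub>0\<close> survives to every page of
  the second spectral sequence (\<open>staircase_inv_page_nonzero\<close>).  Every component of \<open>A\<close> is \<open>R\<close> or zero,
  so \<open>A\<close> lives in any type into which the carrier of \<open>R\<close> embeds.
\<close>

section \<open>Model structures and the identity adjunction\<close>

lemma (in category) HomD:
  assumes "f \<in> Hom C X Y"
  shows "f \<in> Ar C" "Dom C f = X" "Cod C f = Y" "X \<in> Ob C" "Y \<in> Ob C"
  using assms dom_ob[of f] cod_ob[of f] by (auto simp: Hom_def)

lemma (in category) retract_argument:
  assumes f: "f \<in> Hom C X Y" and i: "i \<in> Hom C X Z" and p: "p \<in> Hom C Z Y"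
    and fac: "Cmp C p i = f" and l: "lifts C f p"
  shows "retract_of C f i"
proof -
  note F = HomD[OF f] and I = HomD[OF i] and P = HomD[OF p]
  have idY: "Idt C Y \<in> Hom C Y Y" and idX: "Idt C X \<in> Hom C X X"
    using F id_hom by auto
  have "Cmp C p i = Cmp C (Idt C Y) f"
    using fac id_left[OF f] by simp
  then obtain h where h: "h \<in> Hom C Y Z" "Cmp C h f = i" "Cmp C p h = Idt C Y"
    using l i idY F P unfolding lifts_def by auto
  show ?thesis
    unfolding retract_of_def F I
    using F(1) I(1) h p idX id_right[OF f] id_right[OF i] id_right[OF idX] fac
    by (intro conjI bexI[of _ "Idt C X"] bexI[of _ h] bexI[of _ p]) simp_all
qed

text \<open>
  The converse of the lifting axiom: factor \<open>f\<close> as a cofibration followed by a trivial fibration;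
  a lift against the latter exhibits \<open>f\<close> as a retract of the former.
\<close>

lemma (in model_structure) cof_if_lifts:
  assumes f: "f \<in> Ar C" and l: "\<And>p. p \<in> Fib M \<inter> Weq M \<Longrightarrow> lifts C f p"
  shows "f \<in> Cof M"
proof -
  have fh: "f \<in> Hom C (Dom C f) (Cod C f)" using f by (simp add: Hom_def)
  obtain Z i p where *: "i \<in> Hom C (Dom C f) Z" "p \<in> Hom C Z (Cod C f)"
    "i \<in> Cof M" "p \<in> Fib M \<inter> Weq M" "Cmp C p i = f"
    using factorization(2)[OF fh] by blast
  show ?thesis
    using retracts(2)[OF retract_argument[OF fh *(1,2,5) l[OF *(4)]] *(3)] .
qed

lemma (in model_structure) triv_cof_if_lifts:
  assumes f: "f \<in> Ar C" and l: "\<And>p. p \<in> Fib M \<Longrightarrow> lifts C f p"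
  shows "f \<in> Cof M \<inter> Weq M"
proof -
  have fh: "f \<in> Hom C (Dom C f) (Cod C f)" using f by (simp add: Hom_def)
  obtain Z i p where *: "i \<in> Hom C (Dom C f) Z" "p \<in> Hom C Z (Cod C f)"
    "i \<in> Cof M \<inter> Weq M" "p \<in> Fib M" "Cmp C p i = f"
    using factorization(1)[OF fh] by blast
  have "retract_of C f i"
    by (rule retract_argument[OF fh *(1,2,5) l[OF *(4)]])
  then show ?thesis
    using retracts(1,2)[of f i] *(3) by blast
qed

lemma (in category) id_functor_is_functor: "is_functor C C id_functor"
  by unfold_locales (auto simp: id_functor_def)

lemma (in category) id_adjunction: "adjunction C C id_functor id_functor (\<lambda>X Y f. f)"
proof -
  interpret I: is_functor C C id_functor by (rule id_functor_is_functor)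
  show ?thesis
  proof
    fix X' X Y Y' u f v
    assume u: "u \<in> Hom C X' X" and f: "f \<in> Hom C (fun_ob id_functor X) Y" and v: "v \<in> Hom C Y Y'"
    show "Cmp C v (Cmp C f (fun_ar id_functor u)) = Cmp C (fun_ar id_functor v) (Cmp C f u)"
      by (simp add: id_functor_def)
  qed (auto simp: id_functor_def bij_betw_def)
qed

text \<open>
  Fewer fibrations and fewer trivial fibrations leave more maps with the left lifting property
  against them, so \<open>P\<close> has at least the cofibrations and trivial cofibrations of \<open>M\<close>.
\<close>

lemma id_quillen_adjunction:
  assumes M: "model_structure C M" and P: "model_structure C P"
    and W: "Weq P \<subseteq> Weq M" and F: "Fib P \<subseteq> Fib M"
  shows "quillen_adjunction C M C P id_functor id_functor (\<lambda>X Y f. f)"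
proof -
  interpret M: model_structure C M by fact
  interpret P: model_structure C P by fact
  interpret A: adjunction C C id_functor id_functor "\<lambda>X Y f. f" by (rule M.id_adjunction)
  show ?thesis
  proof
    fix f assume f: "f \<in> Cof M"
    show "fun_ar id_functor f \<in> Cof P"
      unfolding id_functor_def using f M.classes(2) M.lifting(2) W F
      by (simp, intro P.cof_if_lifts) blast+
  next
    fix f assume f: "f \<in> Cof M \<inter> Weq M"
    show "fun_ar id_functor f \<in> Cof P \<inter> Weq P"
      unfolding id_functor_def functr.simps using f M.classes(2) M.lifting(1) F
      by (intro P.triv_cof_if_lifts) blast+
  qed
qed

lemma (in model_structure) initial_cofibrant:
  assumes I: "initial_ob C I"
  shows "cofibrant C M I"
proof -
  have I': "I \<in> Ob C" using I by (simp add: initial_ob_def)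
  have id: "Idt C I \<in> Hom C I I" by (rule id_hom[OF I'])
  have "Idt C I \<in> Cof M"
  proof (rule cof_if_lifts)
    show "Idt C I \<in> Ar C" using HomD[OF id] by simp
    fix p assume "p \<in> Fib M \<inter> Weq M"
    show "lifts C (Idt C I) p"
      unfolding lifts_def HomD(2,3)[OF id] by (metis id_right)
  qed
  then show ?thesis using I I' id by (auto simp: cofibrant_def)
qed

text \<open>
  The condition for a Quillen equivalence speaks only of maps from cofibrant to fibrant objects.
  The initial object is cofibrant, and composing \<open>f\<close> with a fibrant replacement of its target in
  \<open>P\<close> brings \<open>f\<close> into this form; two-out-of-three removes the replacement again.
\<close>

lemma quillen_equivalence_weq_from_initial:
  assumes Q: "quillen_equivalence C M C P id_functor id_functor (\<lambda>X Y f. f)"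
    and W: "Weq P \<subseteq> Weq M"
    and I: "initial_ob C I" and T: "terminal_ob C T"
    and f: "f \<in> Hom C I A" and fM: "f \<in> Weq M"
  shows "f \<in> Weq P"
proof -
  interpret Q: quillen_equivalence C M C P id_functor id_functor "\<lambda>X Y f. f" by fact
  have "A \<in> Ob C" using Q.F.C.HomD[OF f] by simp
  then obtain t where t: "t \<in> Hom C A T" using T by (auto simp: terminal_ob_def)
  obtain A' i p where *: "i \<in> Hom C A A'" "p \<in> Hom C A' T" "i \<in> Cof P \<inter> Weq P" "p \<in> Fib P"
    using Q.MD.factorization(1)[OF t] by blast
  have fib: "fibrant C P A'"
    using * T Q.F.C.HomD[OF *(1)] by (auto simp: fibrant_def)
  have gf: "Cmp C i f \<in> Hom C I A'" using Q.F.C.comp_hom f * by blast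
  have "Cmp C i f \<in> Weq M"
    using Q.MC.two_of_three(1)[OF f *(1) fM] * W by blast
  then have "Cmp C i f \<in> Weq P"
    using Q.weq_adjunct[OF Q.MC.initial_cofibrant[OF I] fib] gf by (simp add: id_functor_def)
  then show ?thesis
    using Q.MD.two_of_three(3)[OF f *(1)] * by blast
qed

section \<open>Tuples, cycles and boundaries\<close>

lemma mod_hom_closed: "f \<in> mod_hom R A B \<Longrightarrow> x \<in> carrier A \<Longrightarrow> f x \<in> carrier B"
  by (auto simp: mod_hom_def)

lemma mod_hom_add:
  "f \<in> mod_hom R A B \<Longrightarrow> x \<in> carrier A \<Longrightarrow> y \<in> carrier A \<Longrightarrow>
    f (x \<oplus>\<^bsub>A\<^esub> y) = f x \<oplus>\<^bsub>B\<^esub> f y"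
  by (auto simp: mod_hom_def)

lemma mod_hom_smult:
  "f \<in> mod_hom R A B \<Longrightarrow> c \<in> carrier R \<Longrightarrow> x \<in> carrier A \<Longrightarrow>
    f (c \<odot>\<^bsub>A\<^esub> x) = c \<odot>\<^bsub>B\<^esub> f x"
  by (auto simp: mod_hom_def)

lemma mod_hom_zero:
  assumes A: "module R A" and B: "module R B" and f: "f \<in> mod_hom R A B"
  shows "f \<zero>\<^bsub>A\<^esub> = \<zero>\<^bsub>B\<^esub>"
proof -
  interpret A: module R A by fact
  interpret B: module R B by fact
  have c: "f \<zero>\<^bsub>A\<^esub> \<in> carrier B" using mod_hom_closed[OF f] by simp
  have "f \<zero>\<^bsub>A\<^esub> \<oplus>\<^bsub>B\<^esub> f \<zero>\<^bsub>A\<^esub> = f \<zero>\<^bsub>A\<^esub>"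
    using mod_hom_add[OF f, of "\<zero>\<^bsub>A\<^esub>" "\<zero>\<^bsub>A\<^esub>"] by simp
  then show ?thesis using c B.add.r_cancel_one' by fastforce
qed

lemma alt_zero:
  fixes M :: "('r, 'u) module"
  assumes "module R M"
  shows "alt M i \<zero>\<^bsub>M\<^esub> = \<zero>\<^bsub>M\<^esub>"
proof -
  interpret module R M by fact
  show ?thesis by (simp add: alt_def)
qed

lemma alt_closed:
  fixes M :: "('r, 'u) module"
  assumes "module R M" "x \<in> carrier M"
  shows "alt M i x \<in> carrier M"
proof -
  interpret module R M by fact
  show ?thesis using assms(2) by (simp add: alt_def)
qed

lemma alt_add:
  fixes M :: "('r, 'u) module"
  assumes "module R M" "x \<in> carrier M" "y \<in> carrier M"
  shows "alt M i (x \<oplus>\<^bsub>M\<^esub> y) = alt M i x \<oplus>\<^bsub>M\<^esub> alt M i y"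
proof -
  interpret module R M by fact
  show ?thesis using assms(2,3) by (simp add: alt_def M.minus_add)
qed

lemma alt_smult:
  fixes M :: "('r, 'u) module"
  assumes "module R M" "c \<in> carrier R" "x \<in> carrier M"
  shows "alt M i (c \<odot>\<^bsub>M\<^esub> x) = c \<odot>\<^bsub>M\<^esub> alt M i x"
proof -
  interpret module R M by fact
  show ?thesis using assms(2,3) by (simp add: alt_def smult_r_minus)
qed

text \<open>
  If \<open>a\<close> is read as an element of the total complex with leading term in bidegree \<open>(p, q)\<close>, this is
  the component of its differential in column \<open>p - l\<close>; membership of \<open>a\<close> in \<open>ZW\<^sub>n\<close> asks for the
  vanishing of the first \<open>n\<close> of these components.
\<close>

definition total_diff :: "('r, 'u) mcomplex \<Rightarrow> int \<Rightarrow> int \<Rightarrow> 'u list \<Rightarrow> nat \<Rightarrow> 'u" where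
  "total_diff A p q a l = (let B = cmpt A (p - int l, q + 1 - int l) in
     \<Oplus>\<^bsub>B\<^esub>i \<in> {..l}. alt B i (diff A i (p - int (l - i), q - int (l - i)) (a ! (l - i))))"

lemma ZW_iff:
  "a \<in> ZW A n (p, q) \<longleftrightarrow> length a = max 1 n \<and>
     (\<forall>i < max 1 n. a ! i \<in> carrier (cmpt A (p - int i, q - int i))) \<and>
     (\<forall>l < n. total_diff A p q a l = \<zero>\<^bsub>cmpt A (p - int l, q + 1 - int l)\<^esub>)"
  by (auto simp: ZW_def total_diff_def Let_def)

lemma ZW_module_simps:
  "carrier (ZW_module A n (p, q)) = ZW A n (p, q)"
  "\<zero>\<^bsub>ZW_module A n (p, q)\<^esub> = map (\<lambda>i. \<zero>\<^bsub>cmpt A (p - int i, q - int i)\<^esub>) [0..<max 1 n]"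
  "a \<oplus>\<^bsub>ZW_module A n (p, q)\<^esub> b =
     map (\<lambda>i. a ! i \<oplus>\<^bsub>cmpt A (p - int i, q - int i)\<^esub> b ! i) [0..<max 1 n]"
  "c \<odot>\<^bsub>ZW_module A n (p, q)\<^esub> a =
     map (\<lambda>i. c \<odot>\<^bsub>cmpt A (p - int i, q - int i)\<^esub> a ! i) [0..<max 1 n]"
  by (simp_all add: ZW_module_def Let_def)

text \<open>
  A multicomplex without the relations between its maps.  The constructions \<open>ZW\<close>, \<open>BW\<close> and \<open>w\<close> make
  sense at this level, and this structure passes to \<open>inv_mc\<close> without a reindexing of signed sums.
\<close>

locale bigraded_maps =
  fixes R :: "'r ring" and A :: "('r, 'u) mcomplex"
  assumes cmpt_module: "\<And>pq. module R (cmpt A pq)"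
    and diff_hom: "\<And>i pq. diff A i pq \<in> mod_hom R (cmpt A pq) (cmpt A (pq + dbideg i))"
begin

sublocale cmpt: module R "cmpt A pq" for pq
  by (rule cmpt_module)

lemma diff_hom':
  "p' = p - int i \<Longrightarrow> q' = q + 1 - int i \<Longrightarrow>
    diff A i (p, q) \<in> mod_hom R (cmpt A (p, q)) (cmpt A (p', q'))"
  using diff_hom[of i "(p, q)"] by (simp add: dbideg_def add_diff_eq)

lemmas diff_closed = mod_hom_closed[OF diff_hom']
lemmas diff_add = mod_hom_add[OF diff_hom']
lemmas diff_smult = mod_hom_smult[OF diff_hom']
lemmas diff_zero = mod_hom_zero[OF cmpt_module cmpt_module diff_hom']

lemma total_diff_summand_closed:
  assumes "\<And>k. k \<le> l \<Longrightarrow> a ! k \<in> carrier (cmpt A (p - int k, q - int k))" and "i \<le> l"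
  shows "diff A i (p - int (l - i), q - int (l - i)) (a ! (l - i))
    \<in> carrier (cmpt A (p - int l, q + 1 - int l))"
  using assms(2) by (intro diff_closed assms(1)) (auto simp: of_nat_diff)

lemma total_diff_add:
  assumes a: "\<And>k. k \<le> l \<Longrightarrow> a ! k \<in> carrier (cmpt A (p - int k, q - int k))"
    and b: "\<And>k. k \<le> l \<Longrightarrow> b ! k \<in> carrier (cmpt A (p - int k, q - int k))"
    and c: "\<And>k. k \<le> l \<Longrightarrow> c ! k = a ! k \<oplus>\<^bsub>cmpt A (p - int k, q - int k)\<^esub> b ! k"
  shows "total_diff A p q c l =
    total_diff A p q a l \<oplus>\<^bsub>cmpt A (p - int l, q + 1 - int l)\<^esub> total_diff A p q b l"
proof -
  let ?B = "cmpt A (p - int l, q + 1 - int l)"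
  let ?d = "\<lambda>a i. diff A i (p - int (l - i), q - int (l - i)) (a ! (l - i))"
  have cl: "?d a i \<in> carrier ?B" "?d b i \<in> carrier ?B" if "i \<le> l" for i
    using total_diff_summand_closed[OF a that] total_diff_summand_closed[OF b that] by auto
  have "?d c i = ?d a i \<oplus>\<^bsub>?B\<^esub> ?d b i" if "i \<le> l" for i
    using that a[of "l - i"] b[of "l - i"] c[of "l - i"]
    by (simp add: diff_add[where p'="p - int l" and q'="q + 1 - int l"] of_nat_diff)
  then have "alt ?B i (?d c i) = alt ?B i (?d a i) \<oplus>\<^bsub>?B\<^esub> alt ?B i (?d b i)" if "i \<le> l" for i
    using cl that alt_add[OF cmpt_module] by simp
  then have "total_diff A p q c l
      = (\<Oplus>\<^bsub>?B\<^esub>i \<in> {..l}. alt ?B i (?d a i) \<oplus>\<^bsub>?B\<^esub> alt ?B i (?d b i))"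
    unfolding total_diff_def Let_def using cl
    by (intro cmpt.finsum_cong') (auto simp: alt_closed[OF cmpt_module])
  also have "\<dots> = total_diff A p q a l \<oplus>\<^bsub>?B\<^esub> total_diff A p q b l"
    unfolding total_diff_def Let_def using cl
    by (intro cmpt.finsum_addf) (auto simp: alt_closed[OF cmpt_module])
  finally show ?thesis .
qed

lemma total_diff_smult:
  assumes a: "\<And>k. k \<le> l \<Longrightarrow> a ! k \<in> carrier (cmpt A (p - int k, q - int k))"
    and x: "x \<in> carrier R"
    and c: "\<And>k. k \<le> l \<Longrightarrow> c ! k = x \<odot>\<^bsub>cmpt A (p - int k, q - int k)\<^esub> a ! k"
  shows "total_diff A p q c l = x \<odot>\<^bsub>cmpt A (p - int l, q + 1 - int l)\<^esub> total_diff A p q a l"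
proof -
  let ?B = "cmpt A (p - int l, q + 1 - int l)"
  let ?d = "\<lambda>a i. diff A i (p - int (l - i), q - int (l - i)) (a ! (l - i))"
  have cl: "?d a i \<in> carrier ?B" if "i \<le> l" for i
    using total_diff_summand_closed[OF a that] by auto
  have "?d c i = x \<odot>\<^bsub>?B\<^esub> ?d a i" if "i \<le> l" for i
    using that a[of "l - i"] c[of "l - i"] x
    by (simp add: diff_smult[where p'="p - int l" and q'="q + 1 - int l"] of_nat_diff)
  then have "alt ?B i (?d c i) = x \<odot>\<^bsub>?B\<^esub> alt ?B i (?d a i)" if "i \<le> l" for i
    using cl that x alt_smult[OF cmpt_module] by simp
  then have "total_diff A p q c l = (\<Oplus>\<^bsub>?B\<^esub>i \<in> {..l}. x \<odot>\<^bsub>?B\<^esub> alt ?B i (?d a i))"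
    unfolding total_diff_def Let_def using cl x
    by (intro cmpt.finsum_cong') (auto simp: alt_closed[OF cmpt_module])
  also have "\<dots> = x \<odot>\<^bsub>?B\<^esub> total_diff A p q a l"
    unfolding total_diff_def Let_def using cl x
    by (intro cmpt.finsum_smult_ldistr[symmetric]) (auto simp: alt_closed[OF cmpt_module])
  finally show ?thesis .
qed

lemma total_diff_all_zero:
  assumes "\<And>k i. k \<le> l \<Longrightarrow> i \<le> l \<Longrightarrow> k + i = l \<Longrightarrow>
    diff A i (p - int k, q - int k) (a ! k) = \<zero>\<^bsub>cmpt A (p - int l, q + 1 - int l)\<^esub>"
  shows "total_diff A p q a l = \<zero>\<^bsub>cmpt A (p - int l, q + 1 - int l)\<^esub>"
  unfolding total_diff_def Let_def
proof (rule cmpt.add.finprod_one_eqI)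
  fix i assume "i \<in> {..l}"
  then show "alt (cmpt A (p - int l, q + 1 - int l)) i
      (diff A i (p - int (l - i), q - int (l - i)) (a ! (l - i)))
    = \<zero>\<^bsub>cmpt A (p - int l, q + 1 - int l)\<^esub>"
    using assms[of "l - i" i] by (simp only: atMost_iff diff_le_self le_add_diff_inverse2 alt_zero[OF cmpt_module])
qed

lemma total_diff_leading:
  assumes a: "\<And>k. k < l \<Longrightarrow> a ! k = \<zero>\<^bsub>cmpt A (p - int k, q - int k)\<^esub>"
    and al: "a ! l \<in> carrier (cmpt A (p - int l, q - int l))"
  shows "total_diff A p q a l = diff A 0 (p - int l, q - int l) (a ! l)"
proof -
  let ?B = "cmpt A (p - int l, q + 1 - int l)"
  let ?d = "diff A 0 (p - int l, q - int l) (a ! l)"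
  have d: "?d \<in> carrier ?B" using al by (intro diff_closed) auto
  have "alt ?B i (diff A i (p - int (l - i), q - int (l - i)) (a ! (l - i)))
      = (if 0 = i then ?d else \<zero>\<^bsub>?B\<^esub>)" if "i \<le> l" for i
    using that a[of "l - i"]
    by (auto simp: alt_def diff_zero[where p'="p - int l" and q'="q + 1 - int l"] of_nat_diff)
  then have "total_diff A p q a l = (\<Oplus>\<^bsub>?B\<^esub>i \<in> {..l}. if 0 = i then ?d else \<zero>\<^bsub>?B\<^esub>)"
    unfolding total_diff_def Let_def using d by (intro cmpt.finsum_cong') auto
  also have "\<dots> = ?d"
    using d by (intro cmpt.finsum_singleton) auto
  finally show ?thesis .
qed

lemma ZW_zero: "\<zero>\<^bsub>ZW_module A n (p, q)\<^esub> \<in> ZW A n (p, q)"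
  unfolding ZW_iff ZW_module_simps
  by (auto intro!: total_diff_all_zero diff_zero simp del: of_nat_Suc)

lemma ZW_add:
  assumes "a \<in> ZW A n (p, q)" "b \<in> ZW A n (p, q)"
  shows "a \<oplus>\<^bsub>ZW_module A n (p, q)\<^esub> b \<in> ZW A n (p, q)"
proof -
  have "total_diff A p q (a \<oplus>\<^bsub>ZW_module A n (p, q)\<^esub> b) l = \<zero>\<^bsub>cmpt A (p - int l, q + 1 - int l)\<^esub>"
    if "l < n" for l
    using assms that by (subst total_diff_add[of l a p q b]) (auto simp: ZW_iff ZW_module_simps)
  then show ?thesis using assms by (auto simp: ZW_iff ZW_module_simps)
qed

lemma ZW_smult:
  assumes "a \<in> ZW A n (p, q)" "c \<in> carrier R"
  shows "c \<odot>\<^bsub>ZW_module A n (p, q)\<^esub> a \<in> ZW A n (p, q)"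
proof -
  have "total_diff A p q (c \<odot>\<^bsub>ZW_module A n (p, q)\<^esub> a) l = \<zero>\<^bsub>cmpt A (p - int l, q + 1 - int l)\<^esub>"
    if "l < n" for l
    using assms that by (subst total_diff_smult[of l a p q c]) (auto simp: ZW_iff ZW_module_simps)
  then show ?thesis using assms by (auto simp: ZW_iff ZW_module_simps)
qed

text \<open>
  Negatives come from scalar multiplication by \<open>-1\<close>, under which \<open>ZW\<close> is already known to be closed.
\<close>

lemma ZW_abelian_group: "abelian_group (ZW_module A n pq)"
proof -
  obtain p q where pq: "pq = (p, q)" by force
  have cl: "a ! i \<in> carrier (cmpt A (p - int i, q - int i))"
    if "a \<in> ZW A n (p, q)" "i < max 1 n" for a i
    using that by (simp add: ZW_iff)
  have len: "length a = max 1 n" if "a \<in> ZW A n (p, q)" for a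
    using that by (simp add: ZW_iff)
  show ?thesis
    unfolding pq
  proof (rule abelian_groupI, unfold ZW_module_simps(1))
    fix a b c assume *: "a \<in> ZW A n (p, q)" "b \<in> ZW A n (p, q)" "c \<in> ZW A n (p, q)"
    show "a \<oplus>\<^bsub>ZW_module A n (p, q)\<^esub> b \<oplus>\<^bsub>ZW_module A n (p, q)\<^esub> c
        = a \<oplus>\<^bsub>ZW_module A n (p, q)\<^esub> (b \<oplus>\<^bsub>ZW_module A n (p, q)\<^esub> c)"
      using cl[OF *(1)] cl[OF *(2)] cl[OF *(3)]
      by (intro nth_equalityI) (auto simp: ZW_module_simps cmpt.a_assoc)
  next
    fix a b assume *: "a \<in> ZW A n (p, q)" "b \<in> ZW A n (p, q)"
    show "a \<oplus>\<^bsub>ZW_module A n (p, q)\<^esub> b = b \<oplus>\<^bsub>ZW_module A n (p, q)\<^esub> a"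
      using cl[OF *(1)] cl[OF *(2)]
      by (intro nth_equalityI) (auto simp: ZW_module_simps cmpt.a_comm)
  next
    fix a assume *: "a \<in> ZW A n (p, q)"
    show "\<zero>\<^bsub>ZW_module A n (p, q)\<^esub> \<oplus>\<^bsub>ZW_module A n (p, q)\<^esub> a = a"
      using cl[OF *] len[OF *] by (intro nth_equalityI) (auto simp: ZW_module_simps)
    have m1: "\<ominus>\<^bsub>R\<^esub> \<one>\<^bsub>R\<^esub> \<in> carrier R" by simp
    have "(\<ominus>\<^bsub>R\<^esub> \<one>\<^bsub>R\<^esub> \<odot>\<^bsub>ZW_module A n (p, q)\<^esub> a) \<oplus>\<^bsub>ZW_module A n (p, q)\<^esub> a
        = \<zero>\<^bsub>ZW_module A n (p, q)\<^esub>"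
      using cl[OF *] by (intro nth_equalityI)
        (auto simp: ZW_module_simps cmpt.smult_l_minus cmpt.l_neg)
    then show "\<exists>b \<in> ZW A n (p, q). b \<oplus>\<^bsub>ZW_module A n (p, q)\<^esub> a = \<zero>\<^bsub>ZW_module A n (p, q)\<^esub>"
      using ZW_smult[OF * m1] by blast
  qed (auto intro: ZW_zero ZW_add)
qed

lemma ZW_coset_full:
  assumes a: "a \<in> ZW A n pq"
  shows "ZW A n pq +>\<^bsub>ZW_module A n pq\<^esub> a = ZW A n pq"
proof -
  interpret G: abelian_group "ZW_module A n pq" by (rule ZW_abelian_group)
  have c: "carrier (ZW_module A n pq) = ZW A n pq"
    by (cases pq) (simp add: ZW_module_simps)
  have "b \<in> ZW A n pq +>\<^bsub>ZW_module A n pq\<^esub> a" if "b \<in> ZW A n pq" for b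
  proof -
    have "b = (b \<ominus>\<^bsub>ZW_module A n pq\<^esub> a) \<oplus>\<^bsub>ZW_module A n pq\<^esub> a"
      using a that G.a_inv_closed[of a] G.a_assoc[of b "\<ominus>\<^bsub>ZW_module A n pq\<^esub> a" a]
      by (simp add: c a_minus_def G.l_neg)
    then show ?thesis
      unfolding a_r_coset_def'
      using G.minus_closed[of b a] a that unfolding c by blast
  qed
  then show ?thesis
    unfolding a_r_coset_def' using G.a_closed a unfolding c by blast
qed

text \<open>
  A page on which every cycle is a boundary has the single element \<open>ZW A n pq\<close>; the operations are
  recorded because an isomorphism of pages has to respect them.
\<close>

lemma zero_page:
  assumes w: "w_image A n pq = ZW A n pq"
  shows "carrier (page A n pq) = {ZW A n pq}"
    and "ZW A n pq \<oplus>\<^bsub>page A n pq\<^esub> ZW A n pq = ZW A n pq"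
    and "c \<in> carrier R \<Longrightarrow> c \<odot>\<^bsub>page A n pq\<^esub> ZW A n pq = ZW A n pq"
proof -
  interpret G: abelian_group "ZW_module A n pq" by (rule ZW_abelian_group)
  have c: "carrier (ZW_module A n pq) = ZW A n pq"
    by (cases pq) (simp add: ZW_module_simps)
  have z: "\<zero>\<^bsub>ZW_module A n pq\<^esub> \<in> ZW A n pq"
    using G.zero_closed c by simp
  show "carrier (page A n pq) = {ZW A n pq}"
    using z by (auto simp: page_def quot_module_def A_RCOSETS_def' w c ZW_coset_full)
  have "set_add (ZW_module A n pq) (ZW A n pq) (ZW A n pq)
      = (\<Union>a \<in> ZW A n pq. ZW A n pq +>\<^bsub>ZW_module A n pq\<^esub> a)"
    by (auto simp: set_add_def' a_r_coset_def')
  then show "ZW A n pq \<oplus>\<^bsub>page A n pq\<^esub> ZW A n pq = ZW A n pq"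
    using z by (auto simp: page_def quot_module_def ZW_coset_full)
  show "c \<odot>\<^bsub>page A n pq\<^esub> ZW A n pq = ZW A n pq" if "c \<in> carrier R"
    using z ZW_smult[of _ n "fst pq" "snd pq" c] that
    by (auto simp: page_def quot_module_def w ZW_coset_full)
qed

text \<open>
  If all earlier entries of a cycle vanish, its condition in column \<open>p - k\<close> reduces to
  \<open>d\<^sub>0 a\<^sub>k = 0\<close>.  So where \<open>d\<^sub>0\<close> is injective the entries of a cycle vanish one after another.
\<close>

lemma ZW_eq_zero:
  assumes inj: "\<And>k x. x \<in> carrier (cmpt A (p - int k, q - int k)) \<Longrightarrow>
      diff A 0 (p - int k, q - int k) x = \<zero>\<^bsub>cmpt A (p - int k, q + 1 - int k)\<^esub> \<Longrightarrow>
      x = \<zero>\<^bsub>cmpt A (p - int k, q - int k)\<^esub>"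
    and n: "n \<ge> 1"
  shows "ZW A n (p, q) = {\<zero>\<^bsub>ZW_module A n (p, q)\<^esub>}"
proof -
  have "a = \<zero>\<^bsub>ZW_module A n (p, q)\<^esub>" if a: "a \<in> ZW A n (p, q)" for a
  proof -
    have e: "a ! k = \<zero>\<^bsub>cmpt A (p - int k, q - int k)\<^esub>" if "k < n" for k
      using that
    proof (induction k rule: less_induct)
      case (less k)
      have c: "a ! k \<in> carrier (cmpt A (p - int k, q - int k))"
        using a less.prems by (simp add: ZW_iff)
      have "total_diff A p q a k = diff A 0 (p - int k, q - int k) (a ! k)"
        using less c by (intro total_diff_leading) auto
      then show ?case
        using inj[OF c] a less.prems by (simp add: ZW_iff)
    qed
    show ?thesis
      using e a n by (intro nth_equalityI) (auto simp: ZW_iff ZW_module_simps)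
  qed
  then show ?thesis using ZW_zero by blast
qed

lemma ZW_iff_diff_zero:
  assumes d: "\<And>i k x. x \<in> carrier (cmpt A (p - int k, q - int k)) \<Longrightarrow>
      diff A i (p - int k, q - int k) x = \<zero>\<^bsub>cmpt A (p - int k - int i, q + 1 - int k - int i)\<^esub>"
  shows "a \<in> ZW A n (p, q) \<longleftrightarrow> length a = max 1 n \<and>
    (\<forall>i < max 1 n. a ! i \<in> carrier (cmpt A (p - int i, q - int i)))"
proof -
  have "total_diff A p q a l = \<zero>\<^bsub>cmpt A (p - int l, q + 1 - int l)\<^esub>"
    if "\<forall>i < max 1 n. a ! i \<in> carrier (cmpt A (p - int i, q - int i))" "l < n" for l
  proof (rule total_diff_all_zero)
    fix k i assume "k \<le> l" "i \<le> l" "k + i = l"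
    then show "diff A i (p - int k, q - int k) (a ! k) = \<zero>\<^bsub>cmpt A (p - int l, q + 1 - int l)\<^esub>"
      using that d[of "a ! k" k i] by (auto simp: algebra_simps)
  qed
  then show ?thesis unfolding ZW_iff by blast
qed

text \<open>The contribution of the component \<open>b\<close> to the \<open>j\<close>-th entry of \<open>w\<close>, without the sign \<open>(-1)\<^sup>j\<close>.\<close>

definition w_sum :: "nat \<Rightarrow> int \<Rightarrow> int \<Rightarrow> 'u list \<Rightarrow> nat \<Rightarrow> 'u" where
  "w_sum n p q b j = (\<Oplus>\<^bsub>cmpt A (p - int j, q - int j)\<^esub>i \<in> {j + 1..n - 1 + j}.
     let k = n - 1 + j - i in alt (cmpt A (p - int j, q - int j)) i
       (diff A i (p + int n - 1 - int k, q + int n - 2 - int k) (b ! k)))"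

lemma w_map_nth:
  assumes "n \<ge> 2" "j < n"
  shows "w_map A n (p, q) (b, a, c) ! j =
    diff A j (p, q - 1) a
      \<oplus>\<^bsub>cmpt A (p - int j, q - int j)\<^esub> alt (cmpt A (p - int j, q - int j)) j (w_sum n p q b j)
      \<oplus>\<^bsub>cmpt A (p - int j, q - int j)\<^esub>
        (if j = 0 then \<zero>\<^bsub>cmpt A (p - int j, q - int j)\<^esub> else c ! (j - 1))"
  using assms by (simp add: w_map_def w_sum_def Let_def)

lemma w_map_length: "length (w_map A n (p, q) x) = max 1 n"
  by (cases x) (auto simp: w_map_def)

lemma w_sum_closed:
  assumes b: "\<And>k. k < n - 1 \<Longrightarrow> b ! k \<in> carrier (cmpt A (p + int n - 1 - int k, q + int n - 2 - int k))"
  shows "w_sum n p q b j \<in> carrier (cmpt A (p - int j, q - int j))"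
  unfolding w_sum_def Let_def
proof (rule cmpt.finsum_closed, rule Pi_I, rule alt_closed[OF cmpt_module])
  fix i assume i: "i \<in> {j + 1..n - 1 + j}"
  show "diff A i (p + int n - 1 - int (n - 1 + j - i), q + int n - 2 - int (n - 1 + j - i))
      (b ! (n - 1 + j - i)) \<in> carrier (cmpt A (p - int j, q - int j))"
    using i by (intro diff_closed b) (auto simp: of_nat_diff)
qed

lemma w_sum_zero:
  assumes b: "\<And>i k. k < n - 1 \<Longrightarrow>
    diff A i (p + int n - 1 - int k, q + int n - 2 - int k) (b ! k) =
      \<zero>\<^bsub>cmpt A (p + int n - 1 - int k - int i, q + int n - 1 - int k - int i)\<^esub>"
  shows "w_sum n p q b j = \<zero>\<^bsub>cmpt A (p - int j, q - int j)\<^esub>"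
  unfolding w_sum_def Let_def
proof (rule cmpt.add.finprod_one_eqI)
  fix i assume i: "i \<in> {j + 1..n - 1 + j}"
  define k where "k = n - 1 + j - i"
  have k: "k < n - 1" using i by (auto simp: k_def)
  have e: "p + int n - 1 - int k - int i = p - int j" "q + int n - 1 - int k - int i = q - int j"
    using i by (auto simp: k_def of_nat_diff)
  show "alt (cmpt A (p - int j, q - int j)) i
      (diff A i (p + int n - 1 - int (n - 1 + j - i), q + int n - 2 - int (n - 1 + j - i))
        (b ! (n - 1 + j - i))) = \<zero>\<^bsub>cmpt A (p - int j, q - int j)\<^esub>"
    unfolding k_def[symmetric] b[OF k] e by (rule alt_zero[OF cmpt_module])
qed

lemma w_image_cases:
  assumes "y \<in> w_image A n (p, q)" "n \<ge> 1"
  obtains (one) a where "n = 1" "a \<in> carrier (cmpt A (p, q - 1))" "y = [diff A 0 (p, q - 1) a]"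
  | (many) b a c where "n \<ge> 2" "y = w_map A n (p, q) (b, a, c)"
    "b \<in> ZW A (n - 1) (p + int n - 1, q + int n - 2)"
    "a \<in> carrier (cmpt A (p, q - 1))" "c \<in> ZW A (n - 1) (p - 1, q - 1)"
proof (cases "n = 1")
  case True
  then show ?thesis using assms(1) one by (auto simp: w_image_def BW_def w_map_def)
next
  case False
  have e: "q - 1 + int n - 1 = q + int n - 2" by simp
  show ?thesis using assms False many by (auto simp: w_image_def BW_def e)
qed

lemma w_imageI:
  assumes "n \<ge> 2" "b \<in> ZW A (n - 1) (p + int n - 1, q + int n - 2)"
    "a \<in> carrier (cmpt A (p, q - 1))" "c \<in> ZW A (n - 1) (p - 1, q - 1)"
  shows "w_map A n (p, q) (b, a, c) \<in> w_image A n (p, q)"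
proof -
  have e: "q - 1 + int n - 1 = q + int n - 2" by simp
  show ?thesis using assms by (auto simp: w_image_def BW_def e)
qed

lemma w_image_nonempty: "w_image A n (p, q) \<noteq> {}"
proof -
  have "([], \<zero>\<^bsub>cmpt A (p, q - 1)\<^esub>, []) \<in> BW A n (p, q - 1)
      \<or> (\<zero>\<^bsub>ZW_module A (n - 1) (p + int n - 1, q - 1 + int n - 1)\<^esub>, \<zero>\<^bsub>cmpt A (p, q - 1)\<^esub>,
          \<zero>\<^bsub>ZW_module A (n - 1) (p - 1, q - 1)\<^esub>) \<in> BW A n (p, q - 1)"
    by (simp add: BW_def ZW_zero)
  then show ?thesis unfolding w_image_def by blast
qed

text \<open>
  With all \<open>d\<^sub>i\<close> zero on the total degree from which boundaries come, \<open>w\<close> reduces to the inclusion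
  of its component \<open>c\<close>; this too vanishes if there are no cycles starting in \<open>(p - 1, q - 1)\<close>.
\<close>

lemma w_image_eq_zero:
  assumes d: "\<And>i k x. x \<in> carrier (cmpt A (p - k, q - 1 - k)) \<Longrightarrow>
      diff A i (p - k, q - 1 - k) x = \<zero>\<^bsub>cmpt A (p - k - int i, q - k - int i)\<^esub>"
    and c: "\<And>m. m \<ge> 1 \<Longrightarrow> ZW A m (p - 1, q - 1) = {\<zero>\<^bsub>ZW_module A m (p - 1, q - 1)\<^esub>}"
    and n: "n \<ge> 1"
  shows "w_image A n (p, q) = {\<zero>\<^bsub>ZW_module A n (p, q)\<^esub>}"
proof -
  have "y = \<zero>\<^bsub>ZW_module A n (p, q)\<^esub>" if "y \<in> w_image A n (p, q)" for y
    using that n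
  proof (cases rule: w_image_cases)
    case (one a)
    then show ?thesis using d[of a 0 0] by (simp add: ZW_module_simps)
  next
    case (many b a c')
    have s: "w_sum n p q b j = \<zero>\<^bsub>cmpt A (p - int j, q - int j)\<^esub>" for j
    proof (rule w_sum_zero)
      fix i k assume "k < n - 1"
      \<comment> \<open>The entry \<open>b\<^sub>k\<close> has the same total degree as \<open>(p, q - 1)\<close>, but it sits in a column to the
        right of \<open>p\<close>: hence the negative shift.\<close>
      then have "b ! k \<in> carrier (cmpt A (p - (int k - int n + 1), q - 1 - (int k - int n + 1)))"
        using many(3) by (simp add: ZW_iff algebra_simps)
      from d[OF this, of i]
      show "diff A i (p + int n - 1 - int k, q + int n - 2 - int k) (b ! k) =
          \<zero>\<^bsub>cmpt A (p + int n - 1 - int k - int i, q + int n - 1 - int k - int i)\<^esub>"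
        by (simp add: algebra_simps)
    qed
    have "y ! j = \<zero>\<^bsub>cmpt A (p - int j, q - int j)\<^esub>" if "j < n" for j
    proof -
      have "diff A j (p, q - 1) a = \<zero>\<^bsub>cmpt A (p - int j, q - int j)\<^esub>"
        using d[of a 0 j] many(4) by simp
      moreover have "j > 0 \<Longrightarrow> c' ! (j - 1) = \<zero>\<^bsub>cmpt A (p - int j, q - int j)\<^esub>"
        using c[of "n - 1"] many(1,5) that by (simp add: ZW_module_simps of_nat_diff)
      ultimately show ?thesis
        using many(1,2) that s w_map_nth by (simp add: alt_zero[OF cmpt_module])
    qed
    then show ?thesis
      using many(1,2) by (intro nth_equalityI) (auto simp: ZW_module_simps w_map_length)
  qed
  then show ?thesis using w_image_nonempty[of n p q] by blast
qed

text \<open>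
  If all \<open>d\<^sub>i\<close> vanish on the total degree of \<open>(p, q)\<close>, every tuple is a cycle.  A given tuple \<open>y\<close> is
  then the boundary of \<open>(0, x, c)\<close>, where \<open>d\<^sub>0 x = y\<^sub>0\<close> and \<open>c\<close> absorbs the differences
  \<open>y\<^sub>j - d\<^sub>j x\<close> for \<open>j > 0\<close>.
\<close>

lemma w_image_eq_ZW:
  assumes d: "\<And>i k x. x \<in> carrier (cmpt A (p - k, q - k)) \<Longrightarrow>
      diff A i (p - k, q - k) x = \<zero>\<^bsub>cmpt A (p - k - int i, q + 1 - k - int i)\<^esub>"
    and surj: "\<And>y. y \<in> carrier (cmpt A (p, q)) \<Longrightarrow>
      \<exists>x \<in> carrier (cmpt A (p, q - 1)). diff A 0 (p, q - 1) x = y"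
    and n: "n \<ge> 1"
  shows "w_image A n (p, q) = ZW A n (p, q)"
proof (intro equalityI subsetI)
  have ZW: "a \<in> ZW A m (p, q) \<longleftrightarrow> length a = max 1 m \<and>
    (\<forall>i < max 1 m. a ! i \<in> carrier (cmpt A (p - int i, q - int i)))" for a m
    using d by (intro ZW_iff_diff_zero) blast
  have ZW1: "a \<in> ZW A m (p - 1, q - 1) \<longleftrightarrow> length a = max 1 m \<and>
    (\<forall>i < max 1 m. a ! i \<in> carrier (cmpt A (p - 1 - int i, q - 1 - int i)))" for a m
  proof (rule ZW_iff_diff_zero)
    fix i k x assume "x \<in> carrier (cmpt A (p - 1 - int k, q - 1 - int k))"
    then show "diff A i (p - 1 - int k, q - 1 - int k) x
        = \<zero>\<^bsub>cmpt A (p - 1 - int k - int i, q - 1 + 1 - int k - int i)\<^esub>"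
      using d[of x "1 + int k" i] by (simp add: algebra_simps)
  qed
  {
    fix y assume "y \<in> w_image A n (p, q)"
    then show "y \<in> ZW A n (p, q)"
      using n
    proof (cases rule: w_image_cases)
      case (one a)
      then show ?thesis by (auto simp: ZW intro!: diff_closed)
    next
      case (many b a c)
      have "w_sum n p q b j \<in> carrier (cmpt A (p - int j, q - int j))" for j
        using many(3) by (intro w_sum_closed) (simp add: ZW_iff)
      moreover have "diff A j (p, q - 1) a \<in> carrier (cmpt A (p - int j, q - int j))" for j
        using many(4) by (intro diff_closed) auto
      moreover have "c ! (j - 1) \<in> carrier (cmpt A (p - int j, q - int j))" if "j < n" "j > 0" for j
        using many(1,5) that by (cases j) (auto simp: ZW1 algebra_simps)
      ultimately show ?thesis
        unfolding ZW using many(1,2)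
        by (auto simp: w_map_length w_map_nth alt_closed[OF cmpt_module])
    qed
  }
  fix y assume y: "y \<in> ZW A n (p, q)"
  have yc: "y ! j \<in> carrier (cmpt A (p - int j, q - int j))" if "j < n" for j
    using y that by (simp add: ZW)
  obtain x where x: "x \<in> carrier (cmpt A (p, q - 1))" "diff A 0 (p, q - 1) x = y ! 0"
    using surj[of "y ! 0"] yc[of 0] n by auto
  show "y \<in> w_image A n (p, q)"
  proof (cases "n = 1")
    case True
    then have "y = [diff A 0 (p, q - 1) x]"
      using y x(2) by (cases y) (auto simp: ZW)
    then have "y = w_map A n (p, q) ([], x, [])"
      using True by (simp add: w_map_def)
    then show ?thesis using True x(1) by (auto simp: w_image_def BW_def)
  next
    case False
    then have n2: "n \<ge> 2" using n by simp
    have dx: "diff A j (p, q - 1) x \<in> carrier (cmpt A (p - int j, q - int j))" for j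
      using x by (intro diff_closed) auto
    define b where "b = \<zero>\<^bsub>ZW_module A (n - 1) (p + int n - 1, q + int n - 2)\<^esub>"
    define c where "c = map (\<lambda>j. y ! Suc j \<ominus>\<^bsub>cmpt A (p - int (Suc j), q - int (Suc j))\<^esub>
      diff A (Suc j) (p, q - 1) x) [0..<n - 1]"
    have c: "c \<in> ZW A (n - 1) (p - 1, q - 1)"
    proof -
      have "y ! Suc j \<ominus>\<^bsub>cmpt A (p - int (Suc j), q - int (Suc j))\<^esub> diff A (Suc j) (p, q - 1) x
          \<in> carrier (cmpt A (p - int (Suc j), q - int (Suc j)))" if "j < n - 1" for j
        using that yc[of "Suc j"] dx[of "Suc j"] by (intro cmpt.minus_closed) auto
      then show ?thesis
        using n2 by (auto simp: ZW1 c_def algebra_simps)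
    qed
    have s: "w_sum n p q b j = \<zero>\<^bsub>cmpt A (p - int j, q - int j)\<^esub>" for j
      by (rule w_sum_zero) (auto simp: b_def ZW_module_simps intro!: diff_zero)
    have "y = w_map A n (p, q) (b, x, c)"
    proof (rule nth_equalityI)
      show "length y = length (w_map A n (p, q) (b, x, c))"
        using y by (simp add: ZW w_map_length)
      fix j assume "j < length y"
      then have j: "j < n" using y n by (simp add: ZW)
      have "w_map A n (p, q) (b, x, c) ! j = diff A j (p, q - 1) x
          \<oplus>\<^bsub>cmpt A (p - int j, q - int j)\<^esub>
          (if j = 0 then \<zero>\<^bsub>cmpt A (p - int j, q - int j)\<^esub> else c ! (j - 1))"
        using n2 j dx[of j] by (simp add: w_map_nth s alt_zero[OF cmpt_module])
      also have "\<dots> = y ! j"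
      proof (cases j)
        case 0
        then show ?thesis using x(2) dx[of 0] by simp
      next
        case (Suc i)
        then show ?thesis
          using j yc[of j] dx[of j] cmpt.a_ac[of _ "(p - int j, q - int j)"]
          by (simp add: c_def a_minus_def cmpt.r_neg)
      qed
      finally show "y ! j = w_map A n (p, q) (b, x, c) ! j" ..
    qed
    then show ?thesis
      using w_imageI[OF n2 _ x(1) c, of b] by (simp add: b_def ZW_zero)
  qed
qed

text \<open>
  Only \<open>a\<close> and \<open>b\<close> enter the leading term of \<open>w (b, a, c)\<close>.  This is what lets a nonzero leading
  term survive to all pages.
\<close>

lemma w_image_hd_zero:
  assumes d: "\<And>x. x \<in> carrier (cmpt A (p, q - 1)) \<Longrightarrow> diff A 0 (p, q - 1) x = \<zero>\<^bsub>cmpt A (p, q)\<^esub>"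
    and b: "\<And>m. m \<ge> 1 \<Longrightarrow> ZW A m (p + int m, q + int m - 1) =
      {\<zero>\<^bsub>ZW_module A m (p + int m, q + int m - 1)\<^esub>}"
    and n: "n \<ge> 1" and y: "y \<in> w_image A n (p, q)"
  shows "y ! 0 = \<zero>\<^bsub>cmpt A (p, q)\<^esub>"
  using y n
proof (cases rule: w_image_cases)
  case (one a)
  then show ?thesis using d by simp
next
  case (many b' a c)
  have e: "p + int n - 1 = p + int (n - 1)" "q + int n - 2 = q + int (n - 1) - 1"
    using many(1) by auto
  have "b' = \<zero>\<^bsub>ZW_module A (n - 1) (p + int n - 1, q + int n - 2)\<^esub>"
    using b[of "n - 1"] many(1,3) unfolding e by simp
  then have "w_sum n p q b' 0 = \<zero>\<^bsub>cmpt A (p - int 0, q - int 0)\<^esub>"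
    by (intro w_sum_zero) (auto simp: ZW_module_simps intro!: diff_zero)
  then show ?thesis
    using many(1,2,4) d by (simp add: w_map_nth alt_zero[OF cmpt_module])
qed

end

section \<open>Zero pages, the involution and the zero object\<close>

lemma page_map_iso_if_zero_pages:
  assumes A: "bigraded_maps R A" "w_image A n pq = ZW A n pq"
    and B: "bigraded_maps R B" "w_image B n pq = ZW B n pq"
    and f: "tuple_map f pq ` ZW A n pq \<subseteq> ZW B n pq"
  shows "page_map (A, B, f) n pq \<in> mod_iso R (page A n pq) (page B n pq)"
proof -
  interpret A: bigraded_maps R A by (rule A)
  interpret B: bigraded_maps R B by (rule B)
  have "ZW A n pq \<noteq> {}"
    using A.ZW_zero[of n "fst pq" "snd pq"] by auto
  then have "page_map (A, B, f) n pq (ZW A n pq) = ZW B n pq"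
    using f by (auto simp: page_map_def B(2) B.ZW_coset_full image_subset_iff)
  then show ?thesis
    using A.zero_page[OF A(2)] B.zero_page[OF B(2)]
    by (auto simp: mod_iso_def mod_hom_def bij_betw_def)
qed

lemma inv_bideg_add:
  assumes "i < N"
  shows "inv_bideg N (pq + dbideg i) = inv_bideg N pq + dbideg (N - 1 - i)"
  using assms by (cases pq) (auto simp: inv_bideg_def dbideg_def of_nat_diff algebra_simps)

lemma bigraded_maps_inv:
  assumes "bigraded_maps R A"
  shows "bigraded_maps R (inv_mc N A)"
proof -
  interpret bigraded_maps R A by fact
  show ?thesis
  proof (rule bigraded_maps.intro)
    show "module R (cmpt (inv_mc N A) pq)" for pq
      by (simp add: inv_mc_def cmpt_module)
    fix i pq
    show "diff (inv_mc N A) i pq \<in> mod_hom R (cmpt (inv_mc N A) pq) (cmpt (inv_mc N A) (pq + dbideg i))"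
      using diff_hom[of "N - 1 - i" "inv_bideg N pq"]
      by (auto simp: inv_mc_def inv_bideg_add mod_hom_def cmpt.smult_r_null)
  qed
qed

lemma multicomplex_bigraded_maps: "multicomplex R N A \<Longrightarrow> bigraded_maps R A"
  by (simp add: multicomplex_def bigraded_maps_def)

lemma zero_mc_hom:
  assumes A: "multicomplex R N A" and B: "multicomplex R N B"
  shows "(\<lambda>pq. \<lambda>x \<in> carrier (cmpt A pq). \<zero>\<^bsub>cmpt B pq\<^esub>) \<in> mc_hom R A B"
proof -
  interpret A: bigraded_maps R A using A by (rule multicomplex_bigraded_maps)
  interpret B: bigraded_maps R B using B by (rule multicomplex_bigraded_maps)
  show ?thesis
    using mod_hom_zero[OF B.cmpt_module B.cmpt_module B.diff_hom]
    by (auto simp: mc_hom_def mod_hom_def mod_hom_closed[OF A.diff_hom] B.cmpt.smult_r_null)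
qed

lemma Hom_mC: "Hom (mC R N) A B =
  (if multicomplex R N A \<and> multicomplex R N B then {A} \<times> {B} \<times> mc_hom R A B else {})"
  by (auto simp: Hom_def mC_def)

lemma Ob_mC: "Ob (mC R N) = {A. multicomplex R N A}"
  by (simp add: mC_def)

lemma mc_hom_mod_hom: "f \<in> mc_hom R A B \<Longrightarrow> f pq \<in> mod_hom R (cmpt A pq) (cmpt B pq)"
  unfolding mc_hom_def by blast

lemma mc_hom_eqI:
  assumes "f \<in> mc_hom R A B" "g \<in> mc_hom R A B"
    and "\<And>pq x. x \<in> carrier (cmpt A pq) \<Longrightarrow> f pq x = g pq x"
  shows "f = g"
proof
  fix pq
  show "f pq = g pq"
    using assms by (cases pq, intro extensionalityI[of _ "carrier (cmpt A pq)"]) (auto simp: mc_hom_def)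
qed

lemma zero_mc_initial:
  assumes Z: "multicomplex R N Z" and c: "\<And>pq. carrier (cmpt Z pq) = {\<zero>\<^bsub>cmpt Z pq\<^esub>}"
  shows "initial_ob (mC R N) Z"
proof -
  have "f = g" if A: "multicomplex R N A" and f: "f \<in> mc_hom R Z A" and g: "g \<in> mc_hom R Z A" for A f g
  proof (rule mc_hom_eqI[OF f g])
    fix pq x assume x: "x \<in> carrier (cmpt Z pq)"
    have "module R (cmpt Z pq)" "module R (cmpt A pq)"
      using Z A unfolding multicomplex_def by blast+
    moreover have "x = \<zero>\<^bsub>cmpt Z pq\<^esub>" using c[of pq] x by simp
    ultimately show "f pq x = g pq x"
      using mod_hom_zero[of R "cmpt Z pq" "cmpt A pq" "f pq"]
        mod_hom_zero[of R "cmpt Z pq" "cmpt A pq" "g pq"] f g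
      by (auto simp: mc_hom_def simp del: split_paired_All)
  qed
  then show ?thesis
    using Z zero_mc_hom[OF Z] by (auto simp: initial_ob_def Ob_mC Hom_mC Ex1_def) blast
qed

lemma zero_mc_terminal:
  assumes Z: "multicomplex R N Z" and c: "\<And>pq. carrier (cmpt Z pq) = {\<zero>\<^bsub>cmpt Z pq\<^esub>}"
  shows "terminal_ob (mC R N) Z"
proof -
  have "f = g" if f: "f \<in> mc_hom R A Z" and g: "g \<in> mc_hom R A Z" for A f g
  proof (rule mc_hom_eqI[OF f g])
    fix pq x assume x: "x \<in> carrier (cmpt A pq)"
    have "f pq x \<in> carrier (cmpt Z pq)" "g pq x \<in> carrier (cmpt Z pq)"
      using mod_hom_closed[OF mc_hom_mod_hom[OF f] x] mod_hom_closed[OF mc_hom_mod_hom[OF g] x]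
      by simp_all
    then show "f pq x = g pq x" using c[of pq] by auto
  qed
  then show ?thesis
    using Z zero_mc_hom[OF _ Z] by (auto simp: terminal_ob_def Ob_mC Hom_mC Ex1_def) blast
qed

section \<open>Infinite staircases\<close>

text \<open>
  The ideal \<open>I\<close> as an \<open>R\<close>-module, with its carrier transported along the embedding \<open>\<iota>\<close>.  The two
  trivial ideals provide copies of \<open>R\<close> and of the zero module that share the zero element
  \<open>\<iota> 0\<close>.
\<close>

definition ideal_module :: "'r ring \<Rightarrow> ('r \<Rightarrow> 'u) \<Rightarrow> 'r set \<Rightarrow> ('r, 'u) module" where
  "ideal_module R \<iota> I = (let g = inv_into (carrier R) \<iota> in
     \<lparr>carrier = \<iota> ` I, mult = (\<lambda>x y. x), one = \<iota> \<zero>\<^bsub>R\<^esub>, zero = \<iota> \<zero>\<^bsub>R\<^esub>,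
      add = (\<lambda>x y. \<iota> (g x \<oplus>\<^bsub>R\<^esub> g y)), smult = (\<lambda>c x. \<iota> (c \<otimes>\<^bsub>R\<^esub> g x))\<rparr>)"

lemma ideal_module_module:
  assumes R: "cring R" and \<iota>: "inj_on \<iota> (carrier R)" and I: "ideal I R"
  shows "module R (ideal_module R \<iota> I)"
proof -
  interpret cring R by fact
  interpret I: ideal I R by fact
  have [simp]: "inv_into (carrier R) \<iota> (\<iota> x) = x" if "x \<in> carrier R" for x
    using \<iota> that by simp
  have s: "x \<in> carrier R" if "x \<in> I" for x using I.Icarr that .
  show ?thesis
  proof (intro moduleI abelian_groupI R)
    fix x assume "x \<in> carrier (ideal_module R \<iota> I)"
    then obtain a where a: "a \<in> I" "x = \<iota> a" by (auto simp: ideal_module_def Let_def)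
    have "\<iota> (\<ominus>\<^bsub>R\<^esub> a) \<in> carrier (ideal_module R \<iota> I)"
      using a by (auto simp: ideal_module_def Let_def)
    moreover have "\<iota> (\<ominus>\<^bsub>R\<^esub> a) \<oplus>\<^bsub>ideal_module R \<iota> I\<^esub> x = \<zero>\<^bsub>ideal_module R \<iota> I\<^esub>"
      using a s by (simp add: ideal_module_def Let_def l_neg)
    ultimately show "\<exists>y \<in> carrier (ideal_module R \<iota> I).
        y \<oplus>\<^bsub>ideal_module R \<iota> I\<^esub> x = \<zero>\<^bsub>ideal_module R \<iota> I\<^esub>" ..
  qed (auto simp: ideal_module_def Let_def s a_ac m_assoc l_distr r_distr I.I_l_closed)
qed

text \<open>
  For \<open>T = {..0}\<close> these are the staircases with generators \<open>a\<^sub>i\<close> in \<open>(-i, -i - 1)\<close> and \<open>b\<^sub>i\<close> in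
  \<open>(-i, -i)\<close>.  All generators are represented by \<open>\<iota> 1\<close>, so that the nonzero differentials are identity
  maps.  The columns in \<open>T\<close> are kept as a parameter in order to obtain the zero object, \<open>T = {}\<close>, as
  another instance.
\<close>

definition staircase :: "'r ring \<Rightarrow> ('r \<Rightarrow> 'u) \<Rightarrow> nat \<Rightarrow> int set \<Rightarrow> ('r, 'u) mcomplex" where
  "staircase R \<iota> N T = \<lparr>
     cmpt = (\<lambda>(p, q). ideal_module R \<iota>
       (if p \<in> T \<and> (q = p \<or> q = p - 1) then carrier R else {\<zero>\<^bsub>R\<^esub>})),
     diff = (\<lambda>i (p, q) x. if p \<in> T \<and> q = p - 1 \<and> (i = 0 \<or> i = N - 1) then x else \<iota> \<zero>\<^bsub>R\<^esub>)\<rparr>"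

lemma staircase_zero: "\<zero>\<^bsub>cmpt (staircase R \<iota> N T) pq\<^esub> = \<iota> \<zero>\<^bsub>R\<^esub>"
  by (cases pq) (simp add: staircase_def ideal_module_def Let_def)

lemma staircase_carrier: "carrier (cmpt (staircase R \<iota> N T) (p, q)) =
  (if p \<in> T \<and> (q = p \<or> q = p - 1) then \<iota> ` carrier R else {\<iota> \<zero>\<^bsub>R\<^esub>})"
  by (auto simp: staircase_def ideal_module_def Let_def)

lemma staircase_diff: "diff (staircase R \<iota> N T) i (p, q) x =
  (if p \<in> T \<and> q = p - 1 \<and> (i = 0 \<or> i = N - 1) then x else \<iota> \<zero>\<^bsub>R\<^esub>)"
  by (simp add: staircase_def)

text \<open>
  The last assumption says that the target of \<open>d\<^bsub>N-1\<^esub>\<close> on a generator is again a generator.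
\<close>

context
  fixes R :: "'r ring" and \<iota> :: "'r \<Rightarrow> 'u" and N :: nat and T :: "int set"
  assumes R: "cring R" and \<iota>: "inj_on \<iota> (carrier R)" and N: "N \<ge> 2"
    and T: "\<forall>p \<in> T. p - (int N - 1) \<in> T"
begin

lemma staircase_bigraded_maps: "bigraded_maps R (staircase R \<iota> N T)"
proof (rule bigraded_maps.intro)
  interpret cring R by (rule R)
  fix i :: nat and pq :: bideg
  obtain p q where pq: "pq = (p, q)" by force
  show m: "module R (cmpt (staircase R \<iota> N T) pq)" for pq
    using ideal_module_module[OF R \<iota> oneideal] ideal_module_module[OF R \<iota> zeroideal]
    by (cases pq) (simp add: staircase_def)
  show "diff (staircase R \<iota> N T) i pq
    \<in> mod_hom R (cmpt (staircase R \<iota> N T) pq) (cmpt (staircase R \<iota> N T) (pq + dbideg i))"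
  proof (cases "p \<in> T \<and> q = p - 1 \<and> (i = 0 \<or> i = N - 1)")
    case True
    then have "p - int i \<in> T"
      using bspec[OF T, of p] N by (elim conjE disjE) (simp_all add: of_nat_diff)
    then have "cmpt (staircase R \<iota> N T) (pq + dbideg i) = cmpt (staircase R \<iota> N T) pq"
      using True by (simp add: pq dbideg_def staircase_def)
    moreover have "diff (staircase R \<iota> N T) i pq = (\<lambda>x. x)"
      using True by (simp add: pq fun_eq_iff staircase_diff)
    ultimately show ?thesis by (simp add: mod_hom_def)
  next
    case False
    then have d: "diff (staircase R \<iota> N T) i pq x = \<zero>\<^bsub>cmpt (staircase R \<iota> N T) (pq + dbideg i)\<^esub>" for x
      unfolding pq staircase_diff staircase_zero by (rule if_not_P)
    interpret B: module R "cmpt (staircase R \<iota> N T) (pq + dbideg i)" by (rule m)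
    show ?thesis by (simp add: mod_hom_def d B.smult_r_null)
  qed
qed

lemma staircase_diff_diff:
  "diff (staircase R \<iota> N T) i (pq + dbideg j) (diff (staircase R \<iota> N T) j pq x) = \<iota> \<zero>\<^bsub>R\<^esub>"
  by (cases pq) (auto simp: dbideg_def staircase_diff)

lemma staircase_multicomplex: "multicomplex R N (staircase R \<iota> N T)"
proof -
  interpret bigraded_maps R "staircase R \<iota> N T" by (rule staircase_bigraded_maps)
  have v: "diff (staircase R \<iota> N T) i pq x = \<zero>\<^bsub>cmpt (staircase R \<iota> N T) (pq + dbideg i)\<^esub>"
    if "i \<ge> N" for i pq x
    using that N by (cases pq) (auto simp: staircase_diff staircase_zero)
  have a: "alt (cmpt (staircase R \<iota> N T) pq) i (\<iota> \<zero>\<^bsub>R\<^esub>) = \<iota> \<zero>\<^bsub>R\<^esub>" for i pq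
    using alt_zero[OF cmpt_module, of pq i] by (simp add: staircase_zero)
  have "(\<Oplus>\<^bsub>cmpt (staircase R \<iota> N T) pq'\<^esub>i \<in> {..l}. alt (cmpt (staircase R \<iota> N T) pq') i
      (diff (staircase R \<iota> N T) i (pq + dbideg (l - i)) (diff (staircase R \<iota> N T) (l - i) pq x)))
    = \<zero>\<^bsub>cmpt (staircase R \<iota> N T) pq'\<^esub>"
    for l pq pq' x
    by (rule cmpt.add.finprod_one_eqI) (simp add: staircase_diff_diff a staircase_zero)
  then show ?thesis
    using v by (simp add: multicomplex_def cmpt_module diff_hom Let_def)
qed

text \<open>
  Off the diagonal a component is zero or spanned by some \<open>a\<^sub>i\<close>, and \<open>d\<^sub>0\<close> is injective on it.
\<close>

lemma staircase_ZW_off_diagonal: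
  assumes "q \<noteq> p" and "n \<ge> 1"
  shows "ZW (staircase R \<iota> N T) n (p, q) = {\<zero>\<^bsub>ZW_module (staircase R \<iota> N T) n (p, q)\<^esub>}"
proof -
  interpret bigraded_maps R "staircase R \<iota> N T" by (rule staircase_bigraded_maps)
  show ?thesis
    using assms by (intro ZW_eq_zero) (auto simp: staircase_carrier staircase_diff staircase_zero split: if_splits)
qed

text \<open>
  On the diagonal every tuple is a cycle and \<open>d\<^sub>0\<close> is onto, so every cycle is a boundary.  Off the
  diagonal there are no nonzero cycles.  Nor are there nonzero boundaries there: they come from the
  total degree below, on which all differentials vanish, because it does not contain the \<open>a\<^sub>i\<close>.
\<close>

lemma staircase_page_zero:
  assumes n: "n \<ge> 1"
  shows "w_image (staircase R \<iota> N T) n pq = ZW (staircase R \<iota> N T) n pq"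
proof -
  interpret bigraded_maps R "staircase R \<iota> N T" by (rule staircase_bigraded_maps)
  obtain p q where pq: "pq = (p, q)" by force
  show ?thesis
  proof (cases "q = p")
    case True
    show ?thesis unfolding pq
      using True n by (intro w_image_eq_ZW) (auto simp: staircase_carrier staircase_diff staircase_zero)
  next
    case False
    then show ?thesis
      unfolding pq staircase_ZW_off_diagonal[OF False n]
      using n by (intro w_image_eq_zero staircase_ZW_off_diagonal)
        (auto simp: staircase_carrier staircase_diff staircase_zero)
  qed
qed

text \<open>
  The involution maps \<open>(p, p)\<close> to \<open>(-p, -p)\<close>, so it preserves the degree of the \<open>b\<^sub>i\<close>.
\<close>

lemma staircase_inv_diff_diagonal:
  "diff (inv_mc N (staircase R \<iota> N T)) i (p, p) x = \<iota> \<zero>\<^bsub>R\<^esub>"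
  by (auto simp: inv_mc_def inv_bideg_def staircase_diff staircase_zero algebra_simps)

lemma staircase_inv_zero: "\<zero>\<^bsub>cmpt (inv_mc N (staircase R \<iota> N T)) pq\<^esub> = \<iota> \<zero>\<^bsub>R\<^esub>"
  by (simp add: inv_mc_def staircase_zero)

text \<open>
  The involution maps \<open>(p, p - 1)\<close> to \<open>(N - 1 - p, N - 2 - p)\<close>, so it preserves the degree of the \<open>a\<^sub>i\<close>;
  there the zeroth differential of the involuted multicomplex is \<open>d\<^bsub>N-1\<^esub>\<close>, which is injective.
\<close>

lemma staircase_inv_ZW_subdiagonal:
  assumes "n \<ge> 1"
  shows "ZW (inv_mc N (staircase R \<iota> N T)) n (p, p - 1) =
    {\<zero>\<^bsub>ZW_module (inv_mc N (staircase R \<iota> N T)) n (p, p - 1)\<^esub>}"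
proof -
  interpret bigraded_maps R "inv_mc N (staircase R \<iota> N T)"
    by (rule bigraded_maps_inv[OF staircase_bigraded_maps])
  have b: "inv_bideg N (p, p - 1) = (int N - 1 - p, int N - 1 - p - 1)" for p
    by (simp add: inv_bideg_def algebra_simps)
  have "x = \<iota> \<zero>\<^bsub>R\<^esub>" if "x \<in> carrier (cmpt (inv_mc N (staircase R \<iota> N T)) (p, p - 1))"
    "diff (inv_mc N (staircase R \<iota> N T)) 0 (p, p - 1) x = \<iota> \<zero>\<^bsub>R\<^esub>" for p x
    using that N by (auto simp: inv_mc_def b staircase_carrier staircase_diff split: if_splits)
  from this[of _ "p - int k" for k] show ?thesis
    using assms by (intro ZW_eq_zero) (simp_all add: staircase_inv_zero algebra_simps)
qed

text \<open>
  The only component from which \<open>d\<^bsub>N-1\<^esub>\<close> could reach \<open>b\<^sub>0\<close> lies in column \<open>N - 1\<close>, and \<open>T'\<close> says that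
  it is zero.  The other summands of the leading term come from cycles in the degree of the \<open>a\<^sub>i\<close>, and
  these vanish.
\<close>

lemma staircase_inv_w_image_hd:
  assumes n: "n \<ge> 1" and T': "int N - 1 \<notin> T" and y: "y \<in> w_image (inv_mc N (staircase R \<iota> N T)) n (0, 0)"
  shows "y ! 0 = \<iota> \<zero>\<^bsub>R\<^esub>"
proof -
  interpret bigraded_maps R "inv_mc N (staircase R \<iota> N T)"
    by (rule bigraded_maps_inv[OF staircase_bigraded_maps])
  have "y ! 0 = \<zero>\<^bsub>cmpt (inv_mc N (staircase R \<iota> N T)) (0, 0)\<^esub>"
  proof (rule w_image_hd_zero[OF _ _ n y])
    show "diff (inv_mc N (staircase R \<iota> N T)) 0 (0, 0 - 1) x
        = \<zero>\<^bsub>cmpt (inv_mc N (staircase R \<iota> N T)) (0, 0)\<^esub>" for x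
      using T' N by (simp add: inv_mc_def inv_bideg_def staircase_diff staircase_zero)
    show "ZW (inv_mc N (staircase R \<iota> N T)) m (0 + int m, 0 + int m - 1) =
      {\<zero>\<^bsub>ZW_module (inv_mc N (staircase R \<iota> N T)) m (0 + int m, 0 + int m - 1)\<^esub>}" if "m \<ge> 1" for m
      by (rule staircase_inv_ZW_subdiagonal[OF that])
  qed
  then show ?thesis by (simp add: staircase_inv_zero)
qed

text \<open>
  The tuple \<open>(b\<^sub>0, 0, \<dots>, 0)\<close> is a cycle, and no boundary changes the leading term, so its class
  differs from that of the zero tuple.
\<close>

lemma staircase_inv_page_nonzero:
  assumes n: "n \<ge> 1" and T0: "0 \<in> T" and T': "int N - 1 \<notin> T" and one: "\<one>\<^bsub>R\<^esub> \<noteq> \<zero>\<^bsub>R\<^esub>"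
  shows "\<exists>X \<in> carrier (page (inv_mc N (staircase R \<iota> N T)) n (0, 0)).
    \<exists>Y \<in> carrier (page (inv_mc N (staircase R \<iota> N T)) n (0, 0)). X \<noteq> Y"
proof -
  let ?A = "inv_mc N (staircase R \<iota> N T)"
  interpret R: cring R by (rule R)
  interpret bigraded_maps R ?A
    by (rule bigraded_maps_inv[OF staircase_bigraded_maps])
  interpret A: bigraded_maps R "staircase R \<iota> N T"
    by (rule staircase_bigraded_maps)
  have c0: "cmpt ?A (0, 0) = cmpt (staircase R \<iota> N T) (0, 0)"
    by (simp add: inv_mc_def inv_bideg_def)
  have i1: "\<iota> \<one>\<^bsub>R\<^esub> \<in> carrier (cmpt ?A (0, 0))"
    using T0 by (simp add: c0 staircase_carrier)
  have ZW: "a \<in> ZW ?A n (0, 0) \<longleftrightarrow> length a = max 1 n \<and>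
    (\<forall>i < max 1 n. a ! i \<in> carrier (cmpt ?A (0 - int i, 0 - int i)))" for a
    by (rule ZW_iff_diff_zero) (simp add: staircase_inv_diff_diagonal staircase_inv_zero)
  define z where "z = \<zero>\<^bsub>ZW_module ?A n (0, 0)\<^esub>"
  define e where "e = z[0 := \<iota> \<one>\<^bsub>R\<^esub>]"
  have z: "z \<in> ZW ?A n (0, 0)" unfolding z_def by (rule ZW_zero)
  have len: "length z = max 1 n" using z ZW by blast
  have e: "e \<in> ZW ?A n (0, 0)"
    using z i1 unfolding ZW e_def by (auto simp: nth_list_update)
  have hd: "y ! 0 = a ! 0"
    if y: "y \<in> w_image ?A n (0, 0) +>\<^bsub>ZW_module ?A n (0, 0)\<^esub> a" and a: "a \<in> ZW ?A n (0, 0)" for y a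
  proof -
    obtain w where w: "w \<in> w_image ?A n (0, 0)" "y = w \<oplus>\<^bsub>ZW_module ?A n (0, 0)\<^esub> a"
      using y by (auto simp: a_r_coset_def')
    have "a ! 0 \<in> carrier (cmpt ?A (0, 0))" using a unfolding ZW by force
    moreover have "w ! 0 = \<zero>\<^bsub>cmpt ?A (0, 0)\<^esub>"
      using staircase_inv_w_image_hd[OF n T' w(1)] by (simp add: staircase_inv_zero)
    moreover have "[0..<max 1 n] ! 0 = 0" by (subst nth_upt) auto
    ultimately show ?thesis by (simp add: w(2) ZW_module_simps)
  qed
  let ?X = "\<lambda>a. w_image ?A n (0, 0) +>\<^bsub>ZW_module ?A n (0, 0)\<^esub> a"
  have "?X a \<in> carrier (page ?A n (0, 0))" if "a \<in> ZW ?A n (0, 0)" for a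
    using that by (auto simp: page_def quot_module_def A_RCOSETS_def' ZW_module_simps)
  moreover have "?X e \<noteq> ?X z"
  proof
    assume eq: "?X e = ?X z"
    obtain y where "y \<in> ?X e"
      using w_image_nonempty[of n 0 0] by (auto simp: a_r_coset_def')
    then have "e ! 0 = z ! 0" using hd[OF _ e] hd[OF _ z] eq by metis
    moreover have "e ! 0 = \<iota> \<one>\<^bsub>R\<^esub>" using len by (simp add: e_def)
    moreover have "z ! 0 = \<iota> \<zero>\<^bsub>R\<^esub>"
      by (simp add: z_def ZW_module_simps staircase_inv_zero)
    ultimately show False using \<iota> one by (metis R.one_closed R.zero_closed inj_onD)
  qed
  ultimately show ?thesis using e z by blast
qed

end

lemma bij_betw_singleton_domain_unique:
  assumes "bij_betw f X Y" "X \<subseteq> {x}" "y \<in> Y" "y' \<in> Y"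
  shows "y = y'"
  using assms by (auto simp: bij_betw_def)

lemma page_at_most_one:
  assumes "ZW A n pq \<subseteq> {z}"
  shows "\<exists>X. carrier (page A n pq) \<subseteq> {X}"
  using assms by (cases pq) (auto simp: page_def quot_module_def A_RCOSETS_def' ZW_module_simps)

theorem proposition3p4p1:
  fixes R :: "'r ring" and N r s :: nat
    and \<iota> :: "'r \<Rightarrow> 'u"
    and M\<^sub>r M\<^sub>r\<^sub>s :: "('r, 'u) mc_arrow model_classes"
  assumes "cring R" and "\<one>\<^bsub>R\<^esub> \<noteq> \<zero>\<^bsub>R\<^esub>"
    and "N \<ge> 2"
    and "inj_on \<iota> (carrier R)"
    and "is_model_r R N r M\<^sub>r"
    and "is_model_rs R N r s M\<^sub>r\<^sub>s"
  shows "quillen_adjunction (mC R N) M\<^sub>r (mC R N) M\<^sub>r\<^sub>s id_functor id_functor (\<lambda>X Y f. f)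
    \<and> \<not> quillen_equivalence (mC R N) M\<^sub>r (mC R N) M\<^sub>r\<^sub>s id_functor id_functor (\<lambda>X Y f. f)"
proof
  have Mr: "model_structure (mC R N) M\<^sub>r" "Weq M\<^sub>r = {f \<in> Ar (mC R N). page_quasi_iso R r f}"
    "Fib M\<^sub>r = {f \<in> Ar (mC R N). \<forall>i \<le> r. page_surj i f}"
    using assms(5) by (auto simp: is_model_r_def)
  have Mrs: "model_structure (mC R N) M\<^sub>r\<^sub>s"
    "Weq M\<^sub>r\<^sub>s = {f \<in> Ar (mC R N). page_quasi_iso R r f \<and> page_quasi_iso R s (inv_ar N f)}"
    "Fib M\<^sub>r\<^sub>s = {f \<in> Ar (mC R N). (\<forall>i \<le> r. page_surj i f) \<and> (\<forall>j \<le> s. page_surj j (inv_ar N f))}"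
    using assms(6) by (auto simp: is_model_rs_def)
  have W: "Weq M\<^sub>r\<^sub>s \<subseteq> Weq M\<^sub>r" and F: "Fib M\<^sub>r\<^sub>s \<subseteq> Fib M\<^sub>r"
    by (auto simp: Mr Mrs)
  show "quillen_adjunction (mC R N) M\<^sub>r (mC R N) M\<^sub>r\<^sub>s id_functor id_functor (\<lambda>X Y f. f)"
    by (rule id_quillen_adjunction[OF Mr(1) Mrs(1) W F])
  show "\<not> quillen_equivalence (mC R N) M\<^sub>r (mC R N) M\<^sub>r\<^sub>s id_functor id_functor (\<lambda>X Y f. f)"
  proof
    assume Q: "quillen_equivalence (mC R N) M\<^sub>r (mC R N) M\<^sub>r\<^sub>s id_functor id_functor (\<lambda>X Y f. f)"
    define Z where "Z = staircase R \<iota> N {}"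
    \<comment> \<open>The multicomplex whose first spectral sequence vanishes and whose second one does not.\<close>
    define A where "A = staircase R \<iota> N {..0}"
    have T: "\<forall>p \<in> {..0}. p - (int N - 1) \<in> {..0}" and E: "\<forall>p \<in> {}. p - (int N - 1) \<in> {}"
      using assms(3) by simp_all
    note gen = assms(1,4,3)
    have ZM: "multicomplex R N Z" and Zm: "bigraded_maps R Z"
      unfolding Z_def by (rule staircase_multicomplex[OF gen E], rule staircase_bigraded_maps[OF gen E])
    have AM: "multicomplex R N A" and Am: "bigraded_maps R A"
      unfolding A_def by (rule staircase_multicomplex[OF gen T], rule staircase_bigraded_maps[OF gen T])
    have Zc: "carrier (cmpt Z pq) = {\<zero>\<^bsub>cmpt Z pq\<^esub>}" for pq
      by (cases pq) (simp add: Z_def staircase_carrier staircase_zero)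
    define g where "g = (\<lambda>pq. \<lambda>x \<in> carrier (cmpt Z pq). \<zero>\<^bsub>cmpt A pq\<^esub>)"
    have f: "(Z, A, g) \<in> Hom (mC R N) Z A"
      using zero_mc_hom[OF ZM AM] ZM AM by (simp add: Hom_mC g_def)
    have tm: "tuple_map g pq ` ZW Z n pq \<subseteq> ZW A n pq" for n pq
    proof -
      obtain p q where pq: "pq = (p, q)" by force
      have "tuple_map g pq a = \<zero>\<^bsub>ZW_module A n pq\<^esub>" if "a \<in> ZW Z n pq" for a
        using that unfolding pq by (simp add: ZW_iff tuple_map_def ZW_module_simps g_def)
      then show ?thesis using bigraded_maps.ZW_zero[OF Am] by (auto simp: pq)
    qed
    have "page_map (Z, A, g) (r + 1) pq \<in> mod_iso R (page Z (r + 1) pq) (page A (r + 1) pq)" for pq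
    proof (rule page_map_iso_if_zero_pages[OF Zm _ Am _ tm])
      show "w_image Z (r + 1) pq = ZW Z (r + 1) pq"
        unfolding Z_def by (rule staircase_page_zero[OF gen E]) simp
      show "w_image A (r + 1) pq = ZW A (r + 1) pq"
        unfolding A_def by (rule staircase_page_zero[OF gen T]) simp
    qed
    then have "page_quasi_iso R r (Z, A, g)"
      unfolding page_quasi_iso_def prod.case by blast
    moreover have "(Z, A, g) \<in> Ar (mC R N)"
      using f unfolding Hom_def by blast
    ultimately have "(Z, A, g) \<in> Weq M\<^sub>r"
      unfolding Mr(2) by blast
    then have "(Z, A, g) \<in> Weq M\<^sub>r\<^sub>s"
      by (rule quillen_equivalence_weq_from_initial[OF Q W zero_mc_initial[OF ZM Zc]
          zero_mc_terminal[OF ZM Zc] f])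
    then have "page_quasi_iso R s (inv_ar N (Z, A, g))"
      unfolding Mrs(2) by blast
    then have "page_map (inv_ar N (Z, A, g)) (s + 1) (0, 0)
        \<in> mod_iso R (page (inv_mc N Z) (s + 1) (0, 0)) (page (inv_mc N A) (s + 1) (0, 0))"
      unfolding inv_ar_def page_quasi_iso_def prod.case by blast
    then have bij: "bij_betw (page_map (inv_ar N (Z, A, g)) (s + 1) (0, 0))
        (carrier (page (inv_mc N Z) (s + 1) (0, 0))) (carrier (page (inv_mc N A) (s + 1) (0, 0)))"
      unfolding mod_iso_def by blast
    have "ZW (inv_mc N Z) (s + 1) (0, 0) \<subseteq> {\<zero>\<^bsub>ZW_module (inv_mc N Z) (s + 1) (0, 0)\<^esub>}"
    proof
      fix a assume "a \<in> ZW (inv_mc N Z) (s + 1) (0, 0)"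
      then have "length a = s + 1" "\<And>i. i < s + 1 \<Longrightarrow> a ! i = \<zero>\<^bsub>cmpt (inv_mc N Z) (0 - int i, 0 - int i)\<^esub>"
        by (simp_all add: ZW_iff inv_mc_def Zc)
      then show "a \<in> {\<zero>\<^bsub>ZW_module (inv_mc N Z) (s + 1) (0, 0)\<^esub>}"
        unfolding singleton_iff ZW_module_simps
        by (intro nth_equalityI) (simp_all del: upt_Suc)
    qed
    then obtain X where X: "carrier (page (inv_mc N Z) (s + 1) (0, 0)) \<subseteq> {X}"
      by (rule page_at_most_one[THEN exE])
    have "\<exists>Y \<in> carrier (page (inv_mc N A) (s + 1) (0, 0)).
        \<exists>Y' \<in> carrier (page (inv_mc N A) (s + 1) (0, 0)). Y \<noteq> Y'"
      unfolding A_def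
      by (rule staircase_inv_page_nonzero[OF gen T]) (use assms(2,3) in simp_all)
    then show False
      by (elim bexE notE) (rule bij_betw_singleton_domain_unique[OF bij X])
  qed
qed

end
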